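(* Let $F$ be a Haar system space for which the Rademacher sequence $(r_n)_{n=1}^\infty$, $r_n=\sum_{I\in\mathcal D_n}h_I$, is weakly null. Let $\delta>0$ and let $T:F\to F$ be a bounded linear operator such that for every $j\in\mathbb N$ $$\langle Th_j,h_j\rangle\ \ge\ \delta\,\|h_j\|_F\,\|h_j\|_{F^*}=\delta|I_j| .$$ Let $\eta>0$, and let $(\tilde h_j)_{j=1}^\infty$ be a faithful Haar system such that (i) $\displaystyle\sum_{i=1}^\infty\ \sum_{j\ge 1,\ j\ne i}\Big|\Big\langle T\Big(\frac{\tilde h_i}{\|h_i\|_F}\Big),\frac{\tilde h_j}{\|h_j\|_{F^*}}\Big\rangle\Big|<\eta$, and (ii) $\langle T\tilde h_j,\tilde h_j\rangle\ge\delta\,\|\tilde h_j\|_F\,\|\tilde h_j\|_{F^*}=\delta|I_j|$ for all $j\in\mathbb N$. Then the diagonal operator $D:F\to F$ given by $$D(h_j)=\Big\langle T\Big(\frac{\tilde h_j}{\|h_j\|_F}\Big),\frac{\tilde h_j}{\|h_j\|_{F^*}}\Big\rangle h_j,\qquad j\in\mathbb N,$$ is bounded, and there exist bounded linear operators $A,B:F\to F$ with $\|A\|\,\|B\|\le 1$ such that $\|D-BTA\|\le 2\eta$ and $\|D\|\le\|T\|+2\eta$.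
   Context: Scalars are real; $\mathbb N=\{1,2,\dots\}$; functions live on $[0,1)$ (equivalently $[0,1]$) and $|\cdot|$ is Lebesgue measure. Dyadic intervals: $\mathcal D=\{[\frac{i-1}{2^n},\frac{i}{2^n}): n\ge 0,\ 1\le i\le 2^n\}$, $\mathcal D_n=\{J\in\mathcal D:|J|=2^{-n}\}$, $\mathcal D^+=\mathcal D\cup\{\emptyset\}$. Enumerate $\mathcal D^+$ as $(I_j)_{j\ge1}$ by $I_1=\emptyset$ and $I_{2^n+i}=[\frac{i-1}{2^n},\frac{i}{2^n})$. The Haar function of $I\in\mathcal D$ is $h_I=\chi_{I^+}-\chi_{I^-}$, where $I^+$ and $I^-$ are the left and right halves of $I$; $h_\emptyset=\chi_{[0,1)}$; $h_j=h_{I_j}$. In expressions of the form $\delta|I_j|$, for $j=1$ the quantity $|I_1|$ is understood as $1$ (the measure of the support of $h_1$). A Haar system space $F$ is the completion of $Z=\mathrm{span}\{h_L:L\in\mathcal D^+\}=\mathrm{span}\{\chi_I:I\in\mathcal D\}$ under a norm $\|\cdot\|_F$ such that (1) if $f,g\in Z$ and $|f|,|g|$ have the same distribution then $\|f\|_F=\|g\|_F$; (2) $\|\chi_{[0,1)}\|_F=1$. Such a space is naturally identified with a space of measurable functions contained in $L_1[0,1]$, and $(h_j)_{j\ge1}$ is a monotone Schauder basis of it. Each $g\in Z$ is viewed as an element of $F^*$ via $\langle f,g\rangle=\int_0^1 f(x)g(x)\,dx$, $f\in F$, and $\|g\|_{F^*}$ is its norm in $F^*$. A diagonal operator is one mapping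 each $h_j$ to a scalar multiple of $h_j$. A faithful Haar system is a sequence $(\tilde h_j)_{j=1}^\infty$ of $\{0,\pm1\}$-valued functions with $\tilde h_1=h_1=1_{[0,1)}$ and $\tilde h_j\in\mathrm{span}(h_I:I\in\mathcal D)$ for $j\ge2$, such that $\mathrm{supp}(\tilde h_2)=[0,1)$; for $j=2k-1\ge3$, $\mathrm{supp}(\tilde h_j)=[\tilde h_k=1]$; and for $j=2k\ge4$, $\mathrm{supp}(\tilde h_j)=[\tilde h_k=-1]$. *)

theory Defs
  imports "HOL-Analysis.Analysis" "HOL-Library.Discrete_Functions"
begin

text \<open>Functions on \<open>[0,1)\<close> are represented as functions \<open>real \<Rightarrow> real\<close>; the step functions
  below all vanish outside \<open>[0,1)\<close>, so that for them equality almost everywhere is equality.\<close>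

definition U01 :: "real measure" where
  "U01 = restrict_space lborel {0..<1}"

definition dyadic :: "nat \<Rightarrow> nat \<Rightarrow> real set" where
  "dyadic n i = {(real i - 1) / 2 ^ n ..< real i / 2 ^ n}"

text \<open>\<open>haarI n i\<close> is \<open>h\<^sub>I\<close> for \<open>I = dyadic n i\<close>, whose left and right halves are
  \<open>dyadic (n + 1) (2 * i - 1)\<close> and \<open>dyadic (n + 1) (2 * i)\<close> (for \<open>i \<ge> 1\<close>).\<close>

definition haarI :: "nat \<Rightarrow> nat \<Rightarrow> real \<Rightarrow> real" where
  "haarI n i x = indicator (dyadic (n + 1) (2 * i - 1)) x - indicator (dyadic (n + 1) (2 * i)) x"

text \<open>The enumeration starts at \<open>j = 1\<close>; every \<open>j \<ge> 2\<close> is uniquely \<open>2 ^ n + i\<close> with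
  \<open>1 \<le> i \<le> 2 ^ n\<close>, namely with \<open>n = floor_log (j - 1)\<close>. The value at \<open>j = 0\<close> is never used.\<close>

definition haar :: "nat \<Rightarrow> real \<Rightarrow> real" where
  "haar j = (if j = 1 then indicator {0..<1}
             else haarI (floor_log (j - 1)) (j - 2 ^ floor_log (j - 1)))"

lemma haar_eq_haarI:
  assumes "1 \<le> i" "i \<le> 2 ^ n"
  shows "haar (2 ^ n + i) = haarI n i"
proof -
  have "floor_log (2 ^ n + i - 1) = n"
    by (rule floor_log_eqI) (use assms in auto)
  moreover have "2 ^ n + i \<noteq> 1"
    using assms one_le_power[of "2::nat" n] by linarith
  ultimately show ?thesis by (simp add: haar_def)
qed

definition rademacher :: "nat \<Rightarrow> real \<Rightarrow> real" where
  "rademacher n x = (\<Sum>i = 1..2 ^ n. haarI n i x)"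

definition fun_span :: "(real \<Rightarrow> real) set \<Rightarrow> (real \<Rightarrow> real) set" where
  "fun_span S = {f. \<exists>A c. finite A \<and> A \<subseteq> S \<and> f = (\<lambda>x. \<Sum>g\<in>A. c g * g x)}"

definition Z :: "(real \<Rightarrow> real) set" where
  "Z = fun_span (haar ` {1..})"

definition haar_system_norm :: "((real \<Rightarrow> real) \<Rightarrow> real) \<Rightarrow> bool" where
  "haar_system_norm N \<longleftrightarrow>
     (\<forall>f\<in>Z. 0 \<le> N f) \<and>
     (\<forall>f\<in>Z. N f = 0 \<longleftrightarrow> f = (\<lambda>x. 0)) \<and>
     (\<forall>f\<in>Z. \<forall>c. N (\<lambda>x. c * f x) = \<bar>c\<bar> * N f) \<and>
     (\<forall>f\<in>Z. \<forall>g\<in>Z. N (\<lambda>x. f x + g x) \<le> N f + N g) \<and>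
     (\<forall>f\<in>Z. \<forall>g\<in>Z. distr U01 borel (\<lambda>x. \<bar>f x\<bar>) = distr U01 borel (\<lambda>x. \<bar>g x\<bar>) \<longrightarrow> N f = N g) \<and>
     N (indicator {0..<1}) = 1"

text \<open>The Banach space \<open>'f\<close> together with \<open>emb\<close> is a completion of \<open>(Z, N)\<close>;
  \<open>emb\<close> is the inclusion of \<open>Z\<close>, and its values off \<open>Z\<close> are irrelevant.\<close>

definition haar_system_space ::
    "((real \<Rightarrow> real) \<Rightarrow> real) \<Rightarrow> ((real \<Rightarrow> real) \<Rightarrow> 'f::banach) \<Rightarrow> bool" where
  "haar_system_space N emb \<longleftrightarrow>
     haar_system_norm N \<and>
     (\<forall>f\<in>Z. \<forall>g\<in>Z. emb (\<lambda>x. f x + g x) = emb f + emb g) \<and>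
     (\<forall>f\<in>Z. \<forall>c. emb (\<lambda>x. c * f x) = c *\<^sub>R emb f) \<and>
     (\<forall>f\<in>Z. norm (emb f) = N f) \<and>
     closure (emb ` Z) = UNIV"

text \<open>The identification of elements of the completion with integrable functions on \<open>[0,1)\<close>.
  A Haar system norm dominates the \<open>L\<^sub>1\<close>-norm on \<open>Z\<close>, so a sequence in \<open>Z\<close> that converges to \<open>u\<close>
  in the completion also converges in \<open>L\<^sub>1\<close>, to a limit that depends only on \<open>u\<close>; hence
  \<open>fun_of emb u\<close> exists and is unique almost everywhere. If \<open>u = emb f\<close> it is \<open>f\<close>.\<close>

definition fun_of :: "((real \<Rightarrow> real) \<Rightarrow> 'f::banach) \<Rightarrow> 'f \<Rightarrow> real \<Rightarrow> real" where
  "fun_of emb u = (SOME f. integrable U01 f \<and>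
     (\<forall>z :: nat \<Rightarrow> real \<Rightarrow> real. (\<forall>n. z n \<in> Z) \<and> (\<lambda>n. emb (z n)) \<longlonglongrightarrow> u \<longrightarrow>
        (\<lambda>n. \<integral>x. \<bar>z n x - f x\<bar> \<partial>U01) \<longlonglongrightarrow> 0))"

definition pairing :: "((real \<Rightarrow> real) \<Rightarrow> 'f::banach) \<Rightarrow> 'f \<Rightarrow> (real \<Rightarrow> real) \<Rightarrow> real" where
  "pairing emb u g = (\<integral>x. fun_of emb u x * g x \<partial>U01)"

definition dual_norm :: "((real \<Rightarrow> real) \<Rightarrow> 'f::banach) \<Rightarrow> (real \<Rightarrow> real) \<Rightarrow> real" where
  "dual_norm emb g = onorm (\<lambda>u. pairing emb u g)"

definition weakly_null :: "(nat \<Rightarrow> 'f::real_normed_vector) \<Rightarrow> bool" where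
  "weakly_null u \<longleftrightarrow> (\<forall>\<phi>. bounded_linear \<phi> \<longrightarrow> (\<lambda>n. (\<phi> (u n) :: real)) \<longlonglongrightarrow> 0)"

definition faithful_haar_system :: "(nat \<Rightarrow> real \<Rightarrow> real) \<Rightarrow> bool" where
  "faithful_haar_system ht \<longleftrightarrow>
     (\<forall>j\<ge>1. \<forall>x. ht j x \<in> {0, 1, -1}) \<and>
     ht 1 = haar 1 \<and>
     (\<forall>j\<ge>2. ht j \<in> fun_span (haar ` {2..})) \<and>
     {x. ht 2 x \<noteq> 0} = {0..<1} \<and>
     (\<forall>k\<ge>2. {x. ht (2 * k - 1) x \<noteq> 0} = {x. ht k x = 1}) \<and>
     (\<forall>k\<ge>2. {x. ht (2 * k) x \<noteq> 0} = {x. ht k x = -1})"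

end

theory Submission
  imports Defs
begin

text \<open>
  For faithful Haar systems \<open>g\<close> and \<open>h\<close> consider the operator \<open>u \<mapsto> \<Sum>\<^sub>j \<langle>u, g\<^sub>j\<rangle> / |I\<^sub>j| h\<^sub>j\<close>, which sends \<open>g\<^sub>j\<close> to \<open>h\<^sub>j\<close>.
  It is a contraction for two reasons. First, \<open>\<Sum>\<^sub>j c\<^sub>j g\<^sub>j\<close> and \<open>\<Sum>\<^sub>j c\<^sub>j h\<^sub>j\<close>, summed over the indices up to \<open>2\<^sup>n\<close>,
  have the same distribution, because their values on the supports of level \<open>n\<close> depend only on the
  coefficients and all these supports have measure \<open>2\<^sup>-\<^sup>n\<close> (\<open>N_transfer\<close>). Second, for step functions \<open>f\<close> the sum
  \<open>\<Sum>\<^sub>j \<langle>f, g\<^sub>j\<rangle> / |I\<^sub>j| g\<^sub>j\<close> over these indices is the average of \<open>f\<close> over the supports of level \<open>n\<close>, and averaging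
  does not increase a rearrangement-invariant norm, being a mean of rearrangements (\<open>N_averaging\<close>,
  \<open>N_expectation_le\<close>).

  The partial sums of the operator, applied to a step function, form a bounded martingale and hence
  are Cauchy in \<open>L\<^sub>2\<close>. They are Cauchy in the given norm as soon as the norms of the indicators of \<open>[0, 2\<^sup>-\<^sup>k)\<close>
  tend to zero (\<open>transport_Cauchy\<close>). This is where weak nullness of the Rademacher sequence enters: if
  these norms stay away from zero, the evaluation at \<open>0\<close> is a bounded functional, and it equals \<open>1\<close> on
  every Rademacher function (\<open>initial_norm_tendsto_0\<close>).

  Let \<open>A\<close> send the Haar system to the given faithful system, and let \<open>B\<close> be the operator in the opposite
  direction. Then \<open>B T A\<close> has the numbers \<open>\<langle>T ht\<^sub>i, ht\<^sub>j\<rangle> / |I\<^sub>j|\<close> as its coefficients, and on the diagonal they are the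
  prescribed entries because \<open>\<parallel>h\<^sub>j\<parallel> \<parallel>h\<^sub>j\<parallel>\<^sub>* = |I\<^sub>j|\<close> (\<open>N_mult_dual_norm_haar\<close>). Let \<open>r\<^sub>i\<close> be the
  difference between the prescribed multiple of \<open>h\<^sub>i\<close> and \<open>B T A h\<^sub>i\<close>. By the hypothesis on the
  off-diagonal entries, the quotients \<open>\<parallel>r\<^sub>i\<parallel> / \<parallel>h\<^sub>i\<parallel>\<close> sum to at most \<open>\<eta>\<close>. Since the coefficient of \<open>u\<close> at \<open>h\<^sub>i\<close> is at most
  \<open>\<parallel>u\<parallel> / \<parallel>h\<^sub>i\<parallel>\<close>, the assignment \<open>h\<^sub>i \<mapsto> r\<^sub>i\<close> extends to an operator \<open>R\<close> of norm at most \<open>\<eta>\<close>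
  (\<open>summable_perturbation\<close>), and \<open>D = B T A + R\<close> is the required diagonal operator.
\<close>

section \<open>Dyadic step functions\<close>

definition cell :: "nat \<Rightarrow> real \<Rightarrow> nat" where
  "cell m x = nat \<lfloor>2 ^ m * x\<rfloor>"

definition stepf :: "nat \<Rightarrow> (nat \<Rightarrow> real) \<Rightarrow> real \<Rightarrow> real" where
  "stepf m a x = (if x \<in> {0..<1} then a (cell m x) else 0)"

definition cellset :: "nat \<Rightarrow> nat \<Rightarrow> real set" where
  "cellset m k = {x\<in>{0..<1}. cell m x = k}"

lemma cell_less: "x \<in> {0..<1} \<Longrightarrow> cell m x < 2 ^ m"
  by (auto simp: cell_def nat_less_iff floor_less_iff)

lemma cell_0: "x \<in> {0..<1} \<Longrightarrow> cell 0 x = 0"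
  using cell_less[of x 0] by simp

lemma cell_Suc_div: "0 \<le> x \<Longrightarrow> cell (Suc m) x div 2 = cell m x"
proof -
  assume x: "0 \<le> x"
  have "\<lfloor>2 ^ m * x\<rfloor> = \<lfloor>(2 ^ Suc m * x) / real_of_int 2\<rfloor>" by simp
  also have "\<dots> = \<lfloor>2 ^ Suc m * x\<rfloor> div 2" by (rule floor_divide_real_eq_div) simp
  finally show ?thesis using x by (simp add: cell_def nat_div_distrib)
qed

lemma cell_eq_iff: "0 \<le> x \<Longrightarrow> cell m x = k \<longleftrightarrow> real k / 2 ^ m \<le> x \<and> x < (real k + 1) / 2 ^ m"
proof -
  assume x: "0 \<le> x"
  have "cell m x = k \<longleftrightarrow> \<lfloor>2 ^ m * x\<rfloor> = int k"
    using x by (auto simp: cell_def nat_eq_iff)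
  also have "\<dots> \<longleftrightarrow> real k \<le> 2 ^ m * x \<and> 2 ^ m * x < real k + 1"
    by (simp add: floor_eq_iff)
  also have "\<dots> \<longleftrightarrow> real k / 2 ^ m \<le> x \<and> x < (real k + 1) / 2 ^ m"
    by (simp add: field_simps)
  finally show ?thesis .
qed

lemma cellset_eq:
  assumes "k < 2 ^ m"
  shows "cellset m k = {real k / 2 ^ m ..< (real k + 1) / 2 ^ m}"
proof -
  have "real k + 1 \<le> 2 ^ m"
    using assms by (metis Suc_leI add.commute of_nat_Suc of_nat_le_iff of_nat_numeral of_nat_power)
  then have "(real k + 1) / 2 ^ m \<le> 1" by simp
  have "0 \<le> real k / 2 ^ m" by simp
  show ?thesis
  proof (rule set_eqI)
    fix x
    have "real k / 2 ^ m \<le> x \<Longrightarrow> 0 \<le> x" "x < (real k + 1) / 2 ^ m \<Longrightarrow> x < 1"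
      using \<open>(real k + 1) / 2 ^ m \<le> 1\<close> \<open>0 \<le> real k / 2 ^ m\<close> by linarith+
    then show "x \<in> cellset m k \<longleftrightarrow> x \<in> {real k / 2 ^ m ..< (real k + 1) / 2 ^ m}"
      using cell_eq_iff[of x m k] unfolding cellset_def mem_Collect_eq atLeastLessThan_iff by blast
  qed
qed

lemma cell_left_endpoint: "cell m (real k / 2 ^ m) = k"
  by (simp add: cell_def)

lemma stepf_left_endpoint: "k < 2 ^ m \<Longrightarrow> stepf m a (real k / 2 ^ m) = a k"
proof -
  assume "k < 2 ^ m"
  then have "real k < 2 ^ m" by (metis of_nat_less_iff of_nat_numeral of_nat_power)
  then show ?thesis by (simp add: stepf_def cell_left_endpoint)
qed

lemma stepf_cong: "(\<And>k. k < 2 ^ m \<Longrightarrow> a k = b k) \<Longrightarrow> stepf m a = stepf m b"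
  by (auto simp: stepf_def cell_less fun_eq_iff)

lemma stepf_Suc: "stepf m a = stepf (Suc m) (\<lambda>k. a (k div 2))"
  by (auto simp: stepf_def fun_eq_iff cell_Suc_div)

lemma stepf_refine: "m \<le> n \<Longrightarrow> \<exists>b. stepf m a = stepf n b"
proof (induction n rule: dec_induct)
  case (step n)
  then show ?case by (metis stepf_Suc)
qed auto

text \<open>The condition \<open>\<psi> 0 0 = 0\<close> keeps the result zero outside \<open>[0,1)\<close>.\<close>

lemma stepf_map2:
  "\<psi> 0 0 = 0 \<Longrightarrow> (\<lambda>x. \<psi> (stepf m a x) (stepf m b x)) = stepf m (\<lambda>k. \<psi> (a k) (b k))"
  by (auto simp: stepf_def fun_eq_iff)

lemma space_U01: "space U01 = {0..<1}"
  by (simp add: U01_def space_restrict_space)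

lemma sets_U01: "A \<in> sets U01 \<longleftrightarrow> A \<in> sets borel \<and> A \<subseteq> {0..<1}"
  by (auto simp: U01_def sets_restrict_space_iff)

lemma emeasure_U01: "A \<subseteq> {0..<1} \<Longrightarrow> emeasure U01 A = emeasure lborel A"
  by (simp add: U01_def emeasure_restrict_space)

lemma finite_measure_U01: "finite_measure U01"
  by (rule finite_measureI) (simp add: space_U01 emeasure_U01)

lemma cellset_measurable: "cellset m k \<in> sets U01"
proof (cases "k < 2 ^ m")
  case True
  then have "cellset m k \<in> sets borel" unfolding cellset_eq[OF True] by simp
  then show ?thesis unfolding sets_U01 by (auto simp: cellset_def)
next
  case False
  then have "cellset m k = {}" unfolding cellset_def using cell_less by fastforce
  then show ?thesis unfolding sets_U01 by simp
qed

lemma emeasure_cellset: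
  assumes "k < 2 ^ m"
  shows "emeasure U01 (cellset m k) = ennreal (1 / 2 ^ m)"
proof -
  have "emeasure U01 (cellset m k) = emeasure lborel (cellset m k)"
    by (rule emeasure_U01) (auto simp: cellset_def)
  also have "\<dots> = emeasure lborel {real k / 2 ^ m ..< (real k + 1) / 2 ^ m}"
    using cellset_eq[OF assms] by simp
  also have "\<dots> = ennreal ((real k + 1) / 2 ^ m - real k / 2 ^ m)"
    by (rule emeasure_lborel_Ico) (simp add: divide_right_mono)
  also have "(real k + 1) / 2 ^ m - real k / 2 ^ m = 1 / 2 ^ m" by (simp add: field_simps)
  finally show ?thesis .
qed

lemma stepf_eq_sum:
  "stepf m a = (\<lambda>x. \<Sum>k<2^m. a k * indicator (cellset m k) x)"
proof
  fix x
  show "stepf m a x = (\<Sum>k<2^m. a k * indicator (cellset m k) x)"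
  proof (cases "x \<in> {0..<1}")
    case True
    have "(\<Sum>k<2^m. a k * indicator (cellset m k) x) = (\<Sum>k<2^m. if k = cell m x then a k else 0)"
      using True by (intro sum.cong) (auto simp: indicator_def cellset_def)
    also have "\<dots> = a (cell m x)" using cell_less[OF True] by simp
    finally show ?thesis using True by (simp add: stepf_def)
  qed (auto simp: stepf_def cellset_def)
qed

lemma measure_cellset:
  "k < 2 ^ m \<Longrightarrow> measure U01 (cellset m k) = 1 / 2 ^ m"
  by (simp add: measure_def emeasure_cellset)

lemma stepf_integrable: "integrable U01 (stepf m a)"
proof -
  show ?thesis unfolding stepf_eq_sum
    by (intro Bochner_Integration.integrable_sum integrable_mult_right integrable_real_indicator
        cellset_measurable) (simp add: emeasure_cellset)
qed

lemma integral_stepf: "(\<integral>x. stepf m a x \<partial>U01) = (\<Sum>k<2^m. a k) / 2 ^ m"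
proof -
  have "(\<integral>x. stepf m a x \<partial>U01) =
     (\<Sum>k<2^m. \<integral>x. a k * indicator (cellset m k) x \<partial>U01)"
    unfolding stepf_eq_sum
    by (intro Bochner_Integration.integral_sum integrable_mult_right integrable_real_indicator
        cellset_measurable) (simp add: emeasure_cellset)
  also have "\<dots> = (\<Sum>k<2^m. a k * (1 / 2 ^ m))"
    using cellset_measurable by (intro sum.cong) (auto simp: measure_cellset)
  finally show ?thesis by (simp add: sum_divide_distrib)
qed

section \<open>The span of the Haar functions\<close>

lemma dyadic_eq_cell: "k < 2 ^ m \<Longrightarrow> dyadic m (Suc k) = cellset m k"
  by (simp add: cellset_eq dyadic_def add.commute)

lemma haar_eq_stepf:
  assumes "i < 2 ^ n"
  shows "haar (Suc (2 ^ n + i)) = stepf (Suc n) (\<lambda>k. if k = 2 * i then 1 else if k = 2 * i + 1 then - 1 else 0)"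
proof -
  have *: "2 * i < 2 ^ Suc n" "2 * i + 1 < 2 ^ Suc n" using assms by auto
  have "haar (Suc (2 ^ n + i)) = haarI n (Suc i)"
    using haar_eq_haarI[of "Suc i" n] assms by simp
  moreover have "2 * Suc i - 1 = Suc (2 * i)" "2 * Suc i = Suc (2 * i + 1)" by auto
  ultimately show ?thesis
    using dyadic_eq_cell[OF *(1)] dyadic_eq_cell[OF *(2)]
    by (auto simp: haarI_def fun_eq_iff stepf_def indicator_def cellset_def)
qed

lemma haar_1: "haar 1 = stepf 0 (\<lambda>_. 1)"
  by (auto simp: haar_def stepf_def)

lemma index_cases:
  assumes "1 \<le> (j::nat)"
  obtains "j = 1" | n i where "i < 2 ^ n" "j = Suc (2 ^ n + i)"
proof (cases "j = 1")
  case False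
  define n where "n = floor_log (j - 1)"
  have "0 < j - 1" using assms False by auto
  then have "2 ^ n \<le> j - 1" "j - 1 < 2 ^ Suc n"
    unfolding n_def using floor_log_exp2_le floor_log_exp2_gt[of "j - 1"] by auto
  then show ?thesis using that(2)[of "j - 1 - 2 ^ n" n] False assms by auto
qed (use that in auto)

lemma haar_is_stepf: "1 \<le> j \<Longrightarrow> \<exists>m a. haar j = stepf m a"
proof (erule index_cases)
  assume "j = 1"
  then show ?thesis using haar_1 by blast
next
  fix n i assume "i < 2 ^ n" "j = Suc (2 ^ n + i)"
  then show ?thesis using haar_eq_stepf by blast
qed

lemma stepf_pair:
  assumes "\<exists>m a. f = stepf m a" "\<exists>m a. g = stepf m a"
  shows "\<exists>m a b. f = stepf m a \<and> g = stepf m b"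
proof -
  obtain m a n b where "f = stepf m a" "g = stepf n b" using assms by blast
  then show ?thesis
    by (metis stepf_refine max.cobounded1 max.cobounded2)
qed

lemma fun_span_induct [consumes 1, case_names zero add]:
  assumes f: "f \<in> fun_span S"
    and "P (\<lambda>x. 0)"
    and "\<And>g h c. g \<in> S \<Longrightarrow> h \<in> fun_span S \<Longrightarrow> P h \<Longrightarrow> P (\<lambda>x. c * g x + h x)"
  shows "P f"
proof -
  obtain A c where A: "finite A" "A \<subseteq> S" "f = (\<lambda>x. \<Sum>g\<in>A. c g * g x)"
    using f by (auto simp: fun_span_def)
  have "P (\<lambda>x. \<Sum>g\<in>A. c g * g x)" using A(1,2)
  proof (induction A rule: finite_induct)
    case (insert g A)
    have "(\<lambda>x. \<Sum>g\<in>A. c g * g x) \<in> fun_span S" using insert by (auto simp: fun_span_def)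
    then show ?case using assms(3)[of g "\<lambda>x. \<Sum>g\<in>A. c g * g x" "c g"] insert by simp
  qed (use assms in auto)
  then show ?thesis using A by simp
qed

lemma fun_span_zero: "(\<lambda>x. 0) \<in> fun_span S"
  unfolding fun_span_def by (rule CollectI, rule exI[of _ "{}"]) auto

lemma fun_span_insert:
  assumes "h \<in> fun_span S" "g \<in> S"
  shows "(\<lambda>x. c * g x + h x) \<in> fun_span S"
proof -
  obtain A d where A: "finite A" "A \<subseteq> S" "h = (\<lambda>x. \<Sum>g\<in>A. d g * g x)"
    using assms by (auto simp: fun_span_def)
  \<comment> \<open>\<open>g\<close> may already occur in \<open>A\<close>, so its two coefficients are added.\<close>
  define d' where "d' = (\<lambda>k. (if k \<in> A then d k else 0) + (if k = g then c else 0))"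
  have "(\<lambda>x. c * g x + h x) = (\<lambda>x. \<Sum>k\<in>insert g A. d' k * k x)"
  proof
    fix x
    have "(\<Sum>k\<in>insert g A. d' k * k x) =
      (\<Sum>k\<in>insert g A. (if k \<in> A then d k else 0) * k x) + (\<Sum>k\<in>insert g A. (if k = g then c else 0) * k x)"
      unfolding d'_def by (simp add: distrib_right sum.distrib)
    also have "(\<Sum>k\<in>insert g A. (if k \<in> A then d k else 0) * k x) = (\<Sum>k\<in>A. d k * k x)"
      using A(1) by (intro sum.mono_neutral_cong_right) auto
    also have "(\<Sum>k\<in>insert g A. (if k = g then c else 0) * k x) = c * g x"
      using A(1) by (simp add: if_distrib[of "\<lambda>t. t * _"] cong: if_cong)
    finally show "c * g x + h x = (\<Sum>k\<in>insert g A. d' k * k x)" using A(3) by simp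
  qed
  then show ?thesis using A assms by (auto simp: fun_span_def)
qed

lemma fun_span_superset: "g \<in> S \<Longrightarrow> g \<in> fun_span S"
  using fun_span_insert[OF fun_span_zero, of g S 1] by simp

lemma fun_span_add: "f \<in> fun_span S \<Longrightarrow> g \<in> fun_span S \<Longrightarrow> (\<lambda>x. f x + g x) \<in> fun_span S"
  by (induction f rule: fun_span_induct) (auto simp: add.assoc intro: fun_span_insert)

lemma fun_span_scale: "f \<in> fun_span S \<Longrightarrow> (\<lambda>x. c * f x) \<in> fun_span S"
  by (induction f rule: fun_span_induct)
    (auto simp: distrib_left mult.assoc[symmetric] intro: fun_span_insert fun_span_zero)

lemma fun_span_sum:
  "(\<And>k. k \<in> I \<Longrightarrow> f k \<in> fun_span S) \<Longrightarrow> (\<lambda>x. \<Sum>k\<in>I. f k x) \<in> fun_span S"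
  by (induction I rule: infinite_finite_induct) (auto intro: fun_span_add fun_span_zero)

lemma Z_zero: "(\<lambda>x. 0) \<in> Z"
  and Z_add: "f \<in> Z \<Longrightarrow> g \<in> Z \<Longrightarrow> (\<lambda>x. f x + g x) \<in> Z"
  and Z_scale: "f \<in> Z \<Longrightarrow> (\<lambda>x. c * f x) \<in> Z"
  and Z_sum: "(\<And>k. k \<in> I \<Longrightarrow> F k \<in> Z) \<Longrightarrow> (\<lambda>x. \<Sum>k\<in>I. F k x) \<in> Z"
  and Z_haar: "1 \<le> j \<Longrightarrow> haar j \<in> Z"
  unfolding Z_def
  by (auto intro: fun_span_zero fun_span_add fun_span_scale fun_span_sum fun_span_superset)

lemma Z_is_stepf: "f \<in> Z \<Longrightarrow> \<exists>m a. f = stepf m a"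
  unfolding Z_def
proof (induction f rule: fun_span_induct)
  case zero
  have "(\<lambda>x. 0) = stepf 0 (\<lambda>_. 0)" by (auto simp: stepf_def)
  then show ?case by metis
next
  case (add g h c)
  then have "\<exists>m a b. g = stepf m a \<and> h = stepf m b"
    using haar_is_stepf by (intro stepf_pair) auto
  then obtain m a b where "g = stepf m a" "h = stepf m b" by blast
  then show ?case using stepf_map2[of "\<lambda>s t. c * s + t" m a b] by auto
qed

text \<open>A step function on the level \<open>m + 1\<close> is the step function of its averages over pairs of
  neighbouring cells plus a combination of the Haar functions of level \<open>m\<close>, which carry the
  half differences.\<close>

lemma stepf_in_Z: "stepf m a \<in> Z"
proof (induction m arbitrary: a)
  case 0
  have "stepf 0 a = (\<lambda>x. a 0 * haar 1 x)"
    unfolding haar_1 by (auto simp: fun_eq_iff stepf_def cell_0)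
  then show ?case using Z_scale[OF Z_haar[of 1]] by simp
next
  case (Suc m)
  define b where "b = (\<lambda>k. (a (2 * k) + a (2 * k + 1)) / 2)"
  define d where "d = (\<lambda>k. (a (2 * k) - a (2 * k + 1)) / 2)"
  have "stepf (Suc m) a = (\<lambda>x. stepf m b x + (\<Sum>i<2^m. d i * haar (Suc (2 ^ m + i)) x))"
  proof
    fix x
    show "stepf (Suc m) a x = stepf m b x + (\<Sum>i<2^m. d i * haar (Suc (2 ^ m + i)) x)"
    proof (cases "x \<in> {0..<1}")
      case True
      let ?k = "cell (Suc m) x"
      have k: "?k div 2 = cell m x" using True by (intro cell_Suc_div) auto
      have "(\<Sum>i<2^m. d i * haar (Suc (2 ^ m + i)) x) =
        (\<Sum>i<2^m. if i = cell m x then d i * (if even ?k then 1 else - 1) else 0)"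
        using True k by (intro sum.cong) (auto simp: haar_eq_stepf stepf_def simp del: power_Suc elim!: evenE oddE)
      also have "\<dots> = d (cell m x) * (if even ?k then 1 else - 1)"
        using cell_less[OF True] by simp
      finally show ?thesis
        using True k by (cases "even ?k") (auto simp: stepf_def b_def d_def field_simps simp del: power_Suc elim!: evenE oddE)
    next
      case False
      then show ?thesis by (auto simp: stepf_def haar_eq_stepf simp del: power_Suc intro!: sum.neutral)
    qed
  qed
  moreover have "(\<lambda>x. \<Sum>i<2^m. d i * haar (Suc (2 ^ m + i)) x) \<in> Z"
    by (intro Z_sum Z_scale Z_haar) auto
  ultimately show ?case using Z_add[OF Suc] by simp
qed

lemma Z_iff: "f \<in> Z \<longleftrightarrow> (\<exists>m a. f = stepf m a)"
  using Z_is_stepf stepf_in_Z by blast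

lemma Z_pairE:
  assumes "f \<in> Z" "g \<in> Z"
  obtains m a b where "f = stepf m a" "g = stepf m b"
  using stepf_pair[of f g] assms Z_is_stepf by blast

lemma Z_map2: "f \<in> Z \<Longrightarrow> g \<in> Z \<Longrightarrow> \<psi> 0 0 = 0 \<Longrightarrow> (\<lambda>x. \<psi> (f x) (g x)) \<in> Z"
  by (erule Z_pairE, assumption) (use stepf_map2 in \<open>auto simp: Z_iff\<close>)

lemma Z_map: "f \<in> Z \<Longrightarrow> \<psi> 0 = 0 \<Longrightarrow> (\<lambda>x. \<psi> (f x)) \<in> Z"
  using Z_map2[of f f "\<lambda>s t. \<psi> s"] by simp

lemma Z_mult: "f \<in> Z \<Longrightarrow> g \<in> Z \<Longrightarrow> (\<lambda>x. f x * g x) \<in> Z"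
  by (rule Z_map2) auto

lemma Z_diff: "f \<in> Z \<Longrightarrow> g \<in> Z \<Longrightarrow> (\<lambda>x. f x - g x) \<in> Z"
  by (rule Z_map2) auto

lemma Z_abs: "f \<in> Z \<Longrightarrow> (\<lambda>x. \<bar>f x\<bar>) \<in> Z"
  by (rule Z_map) auto

lemma Z_integrable: "f \<in> Z \<Longrightarrow> integrable U01 f"
  by (auto simp: Z_iff stepf_integrable)

lemma Z_outside: "f \<in> Z \<Longrightarrow> x \<notin> {0..<1} \<Longrightarrow> f x = 0"
  unfolding Z_iff by (auto simp: stepf_def)

lemma Z_bounded:
  assumes "f \<in> Z"
  obtains K where "0 \<le> K" "\<And>x. \<bar>f x\<bar> \<le> K"
proof -
  obtain m a where f: "f = stepf m a" using assms Z_iff by auto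
  show ?thesis
  proof
    show "0 \<le> (\<Sum>k<2^m. \<bar>a k\<bar>)" by (simp add: sum_nonneg)
    show "\<bar>f x\<bar> \<le> (\<Sum>k<2^m. \<bar>a k\<bar>)" for x
      using cell_less[of x m] by (auto simp: f stepf_def sum_nonneg intro!: member_le_sum[of "cell m x" _ "\<lambda>k. \<bar>a k\<bar>"])
  qed
qed

lemma indicator_Z_subset:
  assumes "indicator E \<in> Z"
  shows "E \<subseteq> {0..<1}"
proof
  fix x assume "x \<in> E"
  then show "x \<in> {0..<1}" using Z_outside[OF assms, of x] by (cases "x \<in> {0..<1}") auto
qed

lemma indicator_Z_sets:
  assumes E: "indicator E \<in> Z"
  shows "E \<in> sets U01"
proof -
  have "(indicator E :: real \<Rightarrow> real) -` {1} \<inter> space U01 \<in> sets U01"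
    using borel_measurable_integrable[OF Z_integrable[OF E]] by (rule measurable_sets) simp
  moreover have "(indicator E :: real \<Rightarrow> real) -` {1} \<inter> space U01 = E"
    using indicator_Z_subset[OF E] by (auto simp: space_U01 indicator_def split: if_splits)
  ultimately show ?thesis by simp
qed

lemma integral_indicator_Z:
  "indicator E \<in> Z \<Longrightarrow> (\<integral>x. indicator E x \<partial>U01) = measure U01 E"
  using indicator_Z_subset by (simp add: space_U01 Int_absorb2)

section \<open>Rearrangement-invariant norms on step functions\<close>

lemma Z_refine: "f \<in> Z \<Longrightarrow> \<exists>m0. \<forall>m\<ge>m0. \<exists>a. f = stepf m a"
  unfolding Z_iff using stepf_refine by blast

text \<open>The structure shared by the dyadic intervals of level \<open>n\<close> and by the supports of the functions of
  level \<open>n\<close> in any faithful Haar system.\<close>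

definition equipartition :: "nat \<Rightarrow> (nat \<Rightarrow> real set) \<Rightarrow> bool" where
  "equipartition n E \<longleftrightarrow>
     (\<forall>i<2^n. E i \<in> sets U01 \<and> emeasure U01 (E i) = ennreal (1 / 2 ^ n)) \<and>
     disjoint_family_on E {..<2^n} \<and> (\<Union>i<2^n. E i) = {0..<1}"

lemma equipartition_cellset: "equipartition m (cellset m)"
  unfolding equipartition_def
  using cellset_measurable emeasure_cellset cell_less
  by (auto simp: disjoint_family_on_def cellset_def)

lemma equipartition_permute:
  assumes "equipartition n E" "\<sigma> permutes {..<2^n}"
  shows "equipartition n (\<lambda>i. E (\<sigma> i))"
proof -
  have s: "\<sigma> i < 2 ^ n \<longleftrightarrow> i < 2 ^ n" for i
    using permutes_in_image[OF assms(2), of i] by simp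
  have "(\<Union>i<2^n. E (\<sigma> i)) = (\<Union>i\<in>\<sigma> ` {..<2^n}. E i)" by blast
  then have "(\<Union>i<2^n. E (\<sigma> i)) = (\<Union>i<2^n. E i)"
    using permutes_image[OF assms(2)] by simp
  moreover have "disjoint_family_on (\<lambda>i. E (\<sigma> i)) {..<2^n}"
  proof (unfold disjoint_family_on_def, intro ballI impI)
    fix i j :: nat assume "i \<in> {..<2^n}" "j \<in> {..<2^n}" "i \<noteq> j"
    then have "\<sigma> i \<in> {..<2^n}" "\<sigma> j \<in> {..<2^n}" "\<sigma> i \<noteq> \<sigma> j"
      using s permutes_inj[OF assms(2)] by (auto dest: injD)
    then show "E (\<sigma> i) \<inter> E (\<sigma> j) = {}"
      using assms(1) unfolding equipartition_def disjoint_family_on_def by blast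
  qed
  ultimately show ?thesis using assms(1) s unfolding equipartition_def by auto
qed

lemma emeasure_equipartition_values:
  assumes E: "equipartition n E" and v: "\<And>i x. i < 2 ^ n \<Longrightarrow> x \<in> E i \<Longrightarrow> f x = v i"
  shows "emeasure U01 {x\<in>{0..<1}. f x \<in> A} = (\<Sum>i\<in>{i\<in>{..<2^n}. v i \<in> A}. ennreal (1 / 2 ^ n))"
proof -
  let ?I = "{i\<in>{..<2^n}. v i \<in> A}"
  have cover: "(\<Union>i<2^n. E i) = {0..<1}" using E by (simp add: equipartition_def)
  have "{x\<in>{0..<1}. f x \<in> A} = (\<Union>i\<in>?I. E i)"
    using v unfolding cover[symmetric] by auto
  moreover have "emeasure U01 (\<Union>i\<in>?I. E i) = (\<Sum>i\<in>?I. emeasure U01 (E i))"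
    using E by (intro sum_emeasure[symmetric]) (auto simp: equipartition_def disjoint_family_on_def)
  ultimately show ?thesis using E by (auto simp: equipartition_def intro: sum.cong)
qed

locale haar_norm =
  fixes N :: "(real \<Rightarrow> real) \<Rightarrow> real"
  assumes haar_system_norm: "haar_system_norm N"
begin

lemma N_nonneg: "f \<in> Z \<Longrightarrow> 0 \<le> N f"
  and N_eq_0: "f \<in> Z \<Longrightarrow> N f = 0 \<longleftrightarrow> f = (\<lambda>x. 0)"
  and N_scale: "f \<in> Z \<Longrightarrow> N (\<lambda>x. c * f x) = \<bar>c\<bar> * N f"
  and N_triangle: "f \<in> Z \<Longrightarrow> g \<in> Z \<Longrightarrow> N (\<lambda>x. f x + g x) \<le> N f + N g"
  and N_distr: "f \<in> Z \<Longrightarrow> g \<in> Z \<Longrightarrow>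
    distr U01 borel (\<lambda>x. \<bar>f x\<bar>) = distr U01 borel (\<lambda>x. \<bar>g x\<bar>) \<Longrightarrow> N f = N g"
  and N_one: "N (indicator {0..<1}) = 1"
  using haar_system_norm unfolding haar_system_norm_def by blast+

lemma N_zero: "N (\<lambda>x. 0) = 0"
  using N_eq_0[OF Z_zero] by simp

lemma N_sum: "(\<And>k. k \<in> I \<Longrightarrow> F k \<in> Z) \<Longrightarrow> N (\<lambda>x. \<Sum>k\<in>I. F k x) \<le> (\<Sum>k\<in>I. N (F k))"
proof (induction I rule: infinite_finite_induct)
  case (insert k I)
  then have "N (\<lambda>x. F k x + (\<Sum>k\<in>I. F k x)) \<le> N (F k) + N (\<lambda>x. \<Sum>k\<in>I. F k x)"
    by (intro N_triangle Z_sum) auto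
  then show ?case using insert by fastforce
qed (auto simp: N_zero)

lemma N_eqI:
  assumes "f \<in> Z" "g \<in> Z"
    and "\<And>A. A \<in> sets borel \<Longrightarrow>
      emeasure U01 {x\<in>{0..<1}. \<bar>f x\<bar> \<in> A} = emeasure U01 {x\<in>{0..<1}. \<bar>g x\<bar> \<in> A}"
  shows "N f = N g"
proof (rule N_distr[OF assms(1,2)])
  have m: "(\<lambda>x. \<bar>h x\<bar>) \<in> U01 \<rightarrow>\<^sub>M borel" if "h \<in> Z" for h
    using Z_integrable[OF Z_abs[OF that]] by (rule borel_measurable_integrable)
  have e: "emeasure (distr U01 borel (\<lambda>x. \<bar>h x\<bar>)) A = emeasure U01 {x\<in>{0..<1}. \<bar>h x\<bar> \<in> A}"
    if "h \<in> Z" "A \<in> sets borel" for h A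
  proof -
    have "(\<lambda>x. \<bar>h x\<bar>) -` A \<inter> space U01 = {x\<in>{0..<1}. \<bar>h x\<bar> \<in> A}"
      unfolding space_U01 by auto
    then show ?thesis using emeasure_distr[OF m[OF that(1)] that(2)] by simp
  qed
  show "distr U01 borel (\<lambda>x. \<bar>f x\<bar>) = distr U01 borel (\<lambda>x. \<bar>g x\<bar>)"
    by (rule measure_eqI) (simp_all only: sets_distr e[OF assms(1)] e[OF assms(2)] assms(3))
qed

lemma N_cong_abs:
  assumes "f \<in> Z" "g \<in> Z" "\<And>x. \<bar>f x\<bar> = \<bar>g x\<bar>"
  shows "N f = N g"
  by (rule N_eqI[OF assms(1,2)]) (simp only: assms(3))

text \<open>Each value \<open>v i\<close> is taken on sets of the same measure, so \<open>f\<close> and \<open>g\<close> are equidistributed.\<close>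

lemma N_equipartition:
  assumes "f \<in> Z" "g \<in> Z" "equipartition n E" "equipartition n F"
    and "\<And>i x. i < 2 ^ n \<Longrightarrow> x \<in> E i \<Longrightarrow> f x = v i"
    and "\<And>i x. i < 2 ^ n \<Longrightarrow> x \<in> F i \<Longrightarrow> g x = v i"
  shows "N f = N g"
proof (rule N_eqI[OF assms(1,2)])
  fix A :: "real set"
  show "emeasure U01 {x\<in>{0..<1}. \<bar>f x\<bar> \<in> A} = emeasure U01 {x\<in>{0..<1}. \<bar>g x\<bar> \<in> A}"
    using emeasure_equipartition_values[OF assms(3), of "\<lambda>x. \<bar>f x\<bar>" "\<lambda>i. \<bar>v i\<bar>" A]
      emeasure_equipartition_values[OF assms(4), of "\<lambda>x. \<bar>g x\<bar>" "\<lambda>i. \<bar>v i\<bar>" A] assms(5,6)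
    by (metis (no_types, lifting))
qed

text \<open>The left function has the value \<open>a (\<sigma> i)\<close> on the cell \<open>i\<close>, the right one has it on the cell
  \<open>\<sigma> i\<close>.\<close>

lemma N_permute:
  assumes "\<sigma> permutes {..<2^m}"
  shows "N (stepf m (a \<circ> \<sigma>)) = N (stepf m a)"
proof (rule N_equipartition[where E = "cellset m" and F = "\<lambda>i. cellset m (\<sigma> i)" and n = m and v = "a \<circ> \<sigma>"])
  show "equipartition m (\<lambda>i. cellset m (\<sigma> i))"
    by (rule equipartition_permute[OF equipartition_cellset assms])
qed (auto simp: stepf_in_Z equipartition_cellset stepf_def cellset_def)

text \<open>Shrinking one value of a step function to \<open>t\<close> times itself, \<open>\<bar>t\<bar> \<le> 1\<close>, is a convex
  combination of keeping it and changing its sign, and a sign change does not affect the norm.\<close>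

lemma N_mono:
  assumes "f \<in> Z" "g \<in> Z" and le: "\<And>x. \<bar>f x\<bar> \<le> \<bar>g x\<bar>"
  shows "N f \<le> N g"
proof -
  obtain m a b where f: "f = stepf m a" and g: "g = stepf m b" using Z_pairE assms(1,2) by blast
  have ab: "\<bar>a k\<bar> \<le> \<bar>b k\<bar>" if "k < 2 ^ m" for k
    using le[of "real k / 2 ^ m"] that by (simp add: f g stepf_left_endpoint)
  \<comment> \<open>The values of \<open>g\<close> are replaced by those of \<open>f\<close> one cell at a time.\<close>
  define h where "h = (\<lambda>K k. if k < K then a k else b k)"
  have "N (stepf m (h K)) \<le> N g" if "K \<le> 2 ^ m" for K
    using that
  proof (induction K)
    case 0
    then show ?case by (simp add: h_def g)
  next
    case (Suc K)
    define t where "t = (if b K = 0 then 0 else a K / b K)"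
    have t: "\<bar>t\<bar> \<le> 1" "a K = t * b K"
      using ab[of K] Suc.prems by (auto simp: t_def)
    define r where "r = (h K)(K := - h K K)"
    have rN: "N (stepf m r) = N (stepf m (h K))"
      by (rule N_cong_abs) (auto simp: stepf_in_Z stepf_def r_def)
    have "stepf m (h (Suc K)) = (\<lambda>x. (1 + t) / 2 * stepf m (h K) x + (1 - t) / 2 * stepf m r x)"
    proof
      fix x
      have "h (Suc K) k = (1 + t) / 2 * h K k + (1 - t) / 2 * r k" for k
        using t(2) by (cases "k = K") (auto simp: h_def r_def less_Suc_eq field_simps)
      then show "stepf m (h (Suc K)) x = (1 + t) / 2 * stepf m (h K) x + (1 - t) / 2 * stepf m r x"
        by (simp add: stepf_def)
    qed
    then have "N (stepf m (h (Suc K))) \<le>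
        N (\<lambda>x. (1 + t) / 2 * stepf m (h K) x) + N (\<lambda>x. (1 - t) / 2 * stepf m r x)"
      using N_triangle[OF Z_scale[OF stepf_in_Z] Z_scale[OF stepf_in_Z],
        of "(1 + t) / 2" m "h K" "(1 - t) / 2" m r] by metis
    also have "\<dots> = (1 + t) / 2 * N (stepf m (h K)) + (1 - t) / 2 * N (stepf m (h K))"
      using t(1) by (simp only: N_scale[OF stepf_in_Z] rN) (simp add: abs_le_iff)
    also have "\<dots> = N (stepf m (h K))" by (simp add: field_simps)
    finally show ?case using Suc by simp
  qed
  from this[of "2 ^ m"] have "N (stepf m (h (2 ^ m))) \<le> N g" by simp
  moreover have "stepf m (h (2 ^ m)) = f" unfolding f by (rule stepf_cong) (simp add: h_def)
  ultimately show ?thesis by simp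
qed

lemma N_abs: "f \<in> Z \<Longrightarrow> N (\<lambda>x. \<bar>f x\<bar>) = N f"
  by (rule N_cong_abs) (auto intro: Z_abs)

text \<open>Replacing \<open>f\<close> by its averages over the level sets of a step function \<open>q\<close> does not increase
  the norm: the averaged function is the mean of the rearrangements of \<open>f\<close> by all permutations of
  the cells that preserve the values of \<open>q\<close>.\<close>

lemma N_averaging:
  assumes "f \<in> Z" "q \<in> Z" "g \<in> Z"
    and avg: "\<And>x. x \<in> {0..<1} \<Longrightarrow>
      g x * (\<integral>y. of_bool (q y = q x) \<partial>U01) = (\<integral>y. f y * of_bool (q y = q x) \<partial>U01)"
  shows "N g \<le> N f"
proof -
  obtain m1 m2 m3 where m: "\<forall>m\<ge>m1. \<exists>a. f = stepf m a" "\<forall>m\<ge>m2. \<exists>a. q = stepf m a"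
    "\<forall>m\<ge>m3. \<exists>a. g = stepf m a"
    using assms(1-3) Z_refine by meson
  define m where "m = max m1 (max m2 m3)"
  have "m1 \<le> m" "m2 \<le> m" "m3 \<le> m" by (auto simp: m_def)
  then obtain a b d where f: "f = stepf m a" and q: "q = stepf m b" and g: "g = stepf m d"
    using m by meson
  define S where "S = {..<(2::nat)^m}"
  have S: "finite S" by (simp add: S_def)
  have avg': "d k * (\<Sum>l\<in>S. of_bool (b l = b k)) = (\<Sum>l\<in>S. a l * of_bool (b l = b k))"
    if "k \<in> S" for k
  proof -
    let ?x = "real k / 2 ^ m"
    have k: "k < 2 ^ m" using that by (simp add: S_def)
    then have x: "?x \<in> {0..<1}" using cellset_eq[OF k] cell_left_endpoint[of m k]
      unfolding cellset_def by (auto simp: divide_strict_right_mono)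
    have qx: "q ?x = b k" unfolding q by (rule stepf_left_endpoint[OF k])
    have 1: "(\<integral>y. of_bool (q y = q ?x) \<partial>U01) = (\<integral>y. stepf m (\<lambda>l. of_bool (b l = b k)) y \<partial>U01)"
      by (rule Bochner_Integration.integral_cong)
        (auto simp: qx, auto simp: q space_U01 stepf_def)
    have 2: "(\<integral>y. f y * of_bool (q y = q ?x) \<partial>U01) = (\<integral>y. stepf m (\<lambda>l. a l * of_bool (b l = b k)) y \<partial>U01)"
      by (rule Bochner_Integration.integral_cong)
        (auto simp: qx, auto simp: q f space_U01 stepf_def)
    from avg[OF x] show ?thesis
      unfolding 1 2 integral_stepf by (simp add: g stepf_left_endpoint[OF k] S_def)
  qed
  \<comment> \<open>\<open>G\<close> consists of the permutations of the cells that preserve the value of \<open>q\<close>.\<close>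
  define G where "G = {\<sigma>. \<sigma> permutes S \<and> (\<forall>k. b (\<sigma> k) = b k)}"
  have "G \<subseteq> {\<sigma>. \<sigma> permutes S}" by (auto simp: G_def)
  then have G: "finite G" using finite_permutations[OF S] by (rule finite_subset)
  have "id \<in> G" by (auto simp: G_def permutes_id)
  then have cG: "0 < real (card G)" using G by (auto simp: card_gt_0_iff)
  define e where "e = (\<lambda>k. (\<Sum>\<sigma>\<in>G. a (\<sigma> k)) / real (card G))"
  \<comment> \<open>Composition with the transposition of \<open>k\<close> and \<open>l\<close> maps \<open>G\<close> onto itself.\<close>
  have e_const: "e k = e l" if "k \<in> S" "l \<in> S" "b k = b l" for k l
  proof -
    let ?\<tau> = "Transposition.transpose k l"
    have t: "?\<tau> permutes S" by (rule permutes_swap_id) (use that in auto)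
    have bt: "b (?\<tau> i) = b i" for i using that(3) by (auto simp: Transposition.transpose_def)
    have G': "\<sigma> \<circ> ?\<tau> \<in> G" if "\<sigma> \<in> G" for \<sigma>
      using that t bt by (auto simp: G_def intro: permutes_compose)
    have "(\<Sum>\<sigma>\<in>G. a (\<sigma> k)) = (\<Sum>\<sigma>\<in>G. a (\<sigma> l))"
      by (rule sum.reindex_bij_witness[of _ "\<lambda>\<sigma>. \<sigma> \<circ> ?\<tau>" "\<lambda>\<sigma>. \<sigma> \<circ> ?\<tau>"])
        (auto simp: G' comp_assoc)
    then show ?thesis by (simp add: e_def)
  qed
  \<comment> \<open>A permutation in \<open>G\<close> only rearranges the values of \<open>a\<close> within each level set of \<open>q\<close>.\<close>
  have e_sum: "(\<Sum>l\<in>S. e l * of_bool (b l = b k)) = (\<Sum>l\<in>S. a l * of_bool (b l = b k))" for k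
  proof -
    have "(\<Sum>l\<in>S. e l * of_bool (b l = b k)) =
        (\<Sum>l\<in>S. \<Sum>\<sigma>\<in>G. a (\<sigma> l) * of_bool (b l = b k)) / real (card G)"
      by (simp add: e_def sum_divide_distrib sum_distrib_right)
    also have "(\<Sum>l\<in>S. \<Sum>\<sigma>\<in>G. a (\<sigma> l) * of_bool (b l = b k)) =
        (\<Sum>\<sigma>\<in>G. \<Sum>l\<in>S. a (\<sigma> l) * of_bool (b l = b k))" by (rule sum.swap)
    also have "\<dots> = (\<Sum>\<sigma>\<in>G. \<Sum>l\<in>S. a l * of_bool (b l = b k))"
    proof (rule sum.cong[OF refl])
      fix \<sigma> assume s: "\<sigma> \<in> G"
      then have p: "\<sigma> permutes S" and bs: "\<And>l. b (\<sigma> l) = b l" by (auto simp: G_def)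
      have "(\<Sum>l\<in>S. a l * of_bool (b l = b k)) =
        (\<Sum>l\<in>S. ((\<lambda>l. a l * of_bool (b l = b k)) \<circ> \<sigma>) l)" using sum.permute[OF p] by metis
      then show "(\<Sum>l\<in>S. a (\<sigma> l) * of_bool (b l = b k)) = (\<Sum>l\<in>S. a l * of_bool (b l = b k))"
        by (simp add: bs)
    qed
    finally show ?thesis using cG by simp
  qed
  have "e k = d k" if k: "k \<in> S" for k
  proof -
    have "(\<Sum>l\<in>S. e l * of_bool (b l = b k)) = (\<Sum>l\<in>S. e k * of_bool (b l = b k))"
    proof (rule sum.cong[OF refl])
      fix l assume "l \<in> S"
      then show "e l * of_bool (b l = b k) = e k * of_bool (b l = b k)"
        using e_const[of l k] k by (cases "b l = b k") simp_all
    qed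
    then have eq: "e k * (\<Sum>l\<in>S. of_bool (b l = b k)) = d k * (\<Sum>l\<in>S. of_bool (b l = b k))"
      unfolding sum_distrib_left[symmetric] using e_sum[of k] avg'[OF k] by linarith
    have "of_bool (b k = b k) \<le> (\<Sum>l\<in>S. of_bool (b l = b k) :: real)"
      by (rule member_le_sum) (use k S in simp_all)
    moreover have "of_bool (b k = b k) = (1::real)" by simp
    ultimately have "(\<Sum>l\<in>S. of_bool (b l = b k) :: real) \<noteq> 0" by linarith
    then show ?thesis using eq by (metis mult_right_cancel)
  qed
  then have "g = stepf m e" unfolding g by (intro stepf_cong) (simp add: S_def)
  also have "\<dots> = (\<lambda>x. \<Sum>\<sigma>\<in>G. (1 / real (card G)) * stepf m (a \<circ> \<sigma>) x)"
    by (auto simp: fun_eq_iff stepf_def e_def sum_divide_distrib)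
  finally have g_eq: "g = (\<lambda>x. \<Sum>\<sigma>\<in>G. (1 / real (card G)) * stepf m (a \<circ> \<sigma>) x)" .
  have "N g \<le> (\<Sum>\<sigma>\<in>G. N (\<lambda>x. (1 / real (card G)) * stepf m (a \<circ> \<sigma>) x))"
    unfolding g_eq by (rule N_sum) (rule Z_scale[OF stepf_in_Z])
  also have "\<dots> = (\<Sum>\<sigma>\<in>G. 1 / real (card G) * N f)"
  proof (rule sum.cong[OF refl])
    fix \<sigma> assume "\<sigma> \<in> G"
    then have "N (stepf m (a \<circ> \<sigma>)) = N f" unfolding f
      by (intro N_permute) (simp add: G_def S_def)
    then show "N (\<lambda>x. (1 / real (card G)) * stepf m (a \<circ> \<sigma>) x) = 1 / real (card G) * N f"
      by (subst N_scale[OF stepf_in_Z]) simp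
  qed
  also have "\<dots> = N f" using cG by simp
  finally show ?thesis .
qed

text \<open>Averaging \<open>f\<close> times the indicator of \<open>E\<close> over \<open>E\<close> and over its complement yields a multiple of
  the indicator, and cutting \<open>f\<close> down to \<open>E\<close> does not increase the norm.\<close>

lemma average_bound:
  assumes f: "f \<in> Z" and E: "indicator E \<in> Z"
  shows "\<bar>\<integral>x. f x * indicator E x \<partial>U01\<bar> * N (indicator E) \<le> measure U01 E * N f"
proof -
  have int: "(\<integral>x. indicator E x \<partial>U01) = measure U01 E"
    by (rule integral_indicator_Z[OF E])
  let ?c = "\<integral>x. f x * indicator E x \<partial>U01"
  have fE: "(\<lambda>x. f x * indicator E x) \<in> Z" by (rule Z_mult[OF f E])
  show ?thesis
  proof (cases "measure U01 E = 0")
    case True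
    obtain K where K: "\<And>x. \<bar>f x\<bar> \<le> K" using Z_bounded[OF f] by metis
    have "\<bar>?c\<bar> \<le> (\<integral>x. \<bar>f x * indicator E x\<bar> \<partial>U01)" by (rule integral_abs_bound)
    also have "\<dots> \<le> (\<integral>x. K * indicator E x \<partial>U01)"
      by (intro integral_mono Z_integrable Z_abs fE Z_scale E) (auto simp: indicator_def K)
    also have "\<dots> = 0" using int True by simp
    finally show ?thesis using True by simp
  next
    case False
    define g where "g = (\<lambda>x. ?c / measure U01 E * indicator E x)"
    have gZ: "g \<in> Z" unfolding g_def by (rule Z_scale[OF E])
    have "N g \<le> N (\<lambda>x. f x * indicator E x)"
    proof (rule N_averaging[OF fE E gZ])
      fix x :: real assume x: "x \<in> {0..<1}"
      show "g x * (\<integral>y. of_bool ((indicator E y :: real) = indicator E x) \<partial>U01) =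
         (\<integral>y. f y * indicator E y * of_bool ((indicator E y :: real) = indicator E x) \<partial>U01)"
      proof (cases "x \<in> E")
        case True
        then have "(\<lambda>y. of_bool ((indicator E y :: real) = indicator E x)) = (indicator E :: real \<Rightarrow> real)"
          by (auto simp: fun_eq_iff indicator_def)
        then have "(\<integral>y. of_bool ((indicator E y :: real) = indicator E x) \<partial>U01) = measure U01 E"
          using int by simp
        moreover have "(\<lambda>y. f y * indicator E y * of_bool ((indicator E y :: real) = indicator E x)) = (\<lambda>y. f y * indicator E y)"
          using True by (auto simp: fun_eq_iff indicator_def)
        ultimately show ?thesis using True False by (simp add: g_def)
      next
        case False
        then have "(\<lambda>y. f y * indicator E y * of_bool ((indicator E y :: real) = indicator E x)) = (\<lambda>y. 0)"
          by (auto simp: fun_eq_iff indicator_def)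
        then show ?thesis using False by (simp add: g_def)
      qed
    qed
    also have "\<dots> \<le> N f" by (rule N_mono[OF fE f]) (simp add: indicator_def)
    finally have "N g \<le> N f" .
    moreover have "N g = \<bar>?c\<bar> / measure U01 E * N (indicator E)"
      unfolding g_def by (subst N_scale[OF E]) simp
    moreover have "0 < measure U01 E" using False by (simp add: zero_less_measure_iff)
    ultimately show ?thesis by (simp add: field_simps)
  qed
qed

lemma indicator_unit_in_Z: "indicator {0..<1} \<in> Z"
  using Z_haar[of 1] by (simp add: haar_def)

text \<open>The average of \<open>\<bar>f\<bar>\<close> over \<open>[0,1)\<close> is a constant function of norm at most that of \<open>f\<close>; this is
  the case \<open>E = [0,1)\<close> of the preceding bound.\<close>

lemma L1_le_N: "f \<in> Z \<Longrightarrow> (\<integral>x. \<bar>f x\<bar> \<partial>U01) \<le> N f"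
proof -
  assume f: "f \<in> Z"
  have "(\<integral>x. \<bar>f x\<bar> * indicator {0..<1} x \<partial>U01) = (\<integral>x. \<bar>f x\<bar> \<partial>U01)"
    by (rule Bochner_Integration.integral_cong) (auto simp: space_U01)
  moreover have "measure U01 {0..<1} = 1" by (simp add: measure_def emeasure_U01)
  ultimately show ?thesis
    using average_bound[OF Z_abs[OF f] indicator_unit_in_Z] by (simp add: N_one N_abs f)
qed

text \<open>For a Haar function \<open>h\<close> this bounds its norm as a functional by \<open>|I| / N h\<close>. It is the averaging
  bound for the product \<open>f h\<close>, which vanishes off \<open>E\<close> and whose norm is at most that of \<open>f\<close>.\<close>

lemma signed_average_bound:
  assumes f: "f \<in> Z" and h: "h \<in> Z" and E: "indicator E \<in> Z"
    and abs: "\<And>x. \<bar>h x\<bar> = indicator E x"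
  shows "\<bar>\<integral>x. f x * h x \<partial>U01\<bar> * N h \<le> measure U01 E * N f"
proof -
  have fh: "(\<lambda>x. f x * h x) \<in> Z" by (rule Z_mult[OF f h])
  have h1: "\<bar>h x\<bar> \<le> 1" for x by (simp add: abs indicator_def)
  have "f x * h x * indicator E x = f x * h x" for x using abs[of x] by (cases "x \<in> E") auto
  then have eq: "(\<lambda>x. f x * h x * indicator E x) = (\<lambda>x. f x * h x)" by blast
  have "\<bar>\<integral>x. f x * h x \<partial>U01\<bar> * N (indicator E) \<le> measure U01 E * N (\<lambda>x. f x * h x)"
    using average_bound[OF fh E] unfolding eq .
  also have "\<dots> \<le> measure U01 E * N f"
    using h1 by (intro mult_left_mono N_mono[OF fh f]) (auto simp: abs_mult intro: mult_left_le)
  finally show ?thesis using N_cong_abs[OF h E] by (simp add: abs)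
qed

end

section \<open>Faithful Haar systems\<close>

lemma dyadic_index_eqs:
  "2 * Suc (2 ^ n + i) - 1 = Suc (2 ^ Suc n + 2 * i)" "2 * Suc (2 ^ n + i) = Suc (2 ^ Suc n + (2 * i + 1))"
  by auto

lemma two_le_index: "2 \<le> Suc (2 ^ n + i)"
  using one_le_power[of "2::nat" n] by linarith

lemma index_casesE:
  assumes "2 \<le> (j::nat)"
  obtains n i where "i < 2 ^ n" "j = Suc (2 ^ n + i)"
proof (rule index_cases[of j])
  show "1 \<le> j" using assms by simp
  show "thesis" if "j = 1" using that assms by simp
qed (rule that)

lemma sum_dyadic_levels:
  fixes f :: "nat \<Rightarrow> 'a::comm_monoid_add"
  shows "(\<Sum>j=1..2 ^ Suc n. f j) = (\<Sum>j=1..2 ^ n. f j) + (\<Sum>i<2^n. f (Suc (2 ^ n + i)))"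
proof -
  have "(\<Sum>j=1..2 ^ Suc n. f j) = (\<Sum>j=1..2 ^ n. f j) + (\<Sum>j=2^n + 1..2 ^ n + 2 ^ n. f j)"
    using sum.ub_add_nat[of 1 "2 ^ n" f "2 ^ n"] by (simp add: mult_2)
  also have "(\<Sum>j=2^n + 1..2 ^ n + 2 ^ n. f j) = (\<Sum>i<2^n. f (Suc (2 ^ n + i)))"
    by (rule sum.reindex_bij_witness[of _ "\<lambda>i. Suc (2 ^ n + i)" "\<lambda>j. j - Suc (2 ^ n)"]) auto
  finally show ?thesis .
qed

text \<open>The functions of level \<open>n\<close> have the indices \<open>2 ^ n + i + 1\<close> with \<open>i < 2 ^ n\<close>. With positions counted
  from \<open>0\<close> in this way, the two children \<open>2 k - 1\<close> and \<open>2 k\<close> of an index \<open>k\<close> at position \<open>i\<close> stand at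
  the positions \<open>2 i\<close> and \<open>2 i + 1\<close> of the next level.\<close>

definition level_supp :: "(nat \<Rightarrow> real \<Rightarrow> real) \<Rightarrow> nat \<Rightarrow> nat \<Rightarrow> real set" where
  "level_supp h n i = {x. h (Suc (2 ^ n + i)) x \<noteq> 0}"

text \<open>The length of \<open>I\<^sub>j\<close>, with the convention that \<open>I\<^sub>1\<close> counts as having length \<open>1\<close>.\<close>

definition interval_len :: "nat \<Rightarrow> real" where
  "interval_len j = (if j = 1 then 1 else 1 / 2 ^ floor_log (j - 1))"

lemma interval_len_1 [simp]: "interval_len (Suc 0) = 1"
  by (simp add: interval_len_def)

lemma interval_len_Suc: "i < 2 ^ n \<Longrightarrow> interval_len (Suc (2 ^ n + i)) = 1 / 2 ^ n"
  using floor_log_eqI[of "2 ^ n + i" n] by (simp add: interval_len_def)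

lemma interval_len_pos: "0 < interval_len j"
  by (simp add: interval_len_def)

definition haar_coef :: "(nat \<Rightarrow> real \<Rightarrow> real) \<Rightarrow> (real \<Rightarrow> real) \<Rightarrow> nat \<Rightarrow> real" where
  "haar_coef h f j = (\<integral>x. f x * h j x \<partial>U01) / interval_len j"

text \<open>The value of the partial sum \<open>\<Sum>j\<le>2^n. c j * h j\<close> on the support at position \<open>i\<close> of level \<open>n\<close>:
  descending to an even child adds the coefficient of the parent, descending to an odd child
  subtracts it. It involves the coefficients but not the functions \<open>h j\<close>.\<close>

primrec tree_value :: "(nat \<Rightarrow> real) \<Rightarrow> nat \<Rightarrow> nat \<Rightarrow> real" where
  "tree_value c 0 i = c 1"
| "tree_value c (Suc n) i = tree_value c n (i div 2) +
     (if even i then c (Suc (2 ^ n + i div 2)) else - c (Suc (2 ^ n + i div 2)))"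

lemma integral_haar: "2 \<le> j \<Longrightarrow> (\<integral>x. haar j x \<partial>U01) = 0"
proof -
  assume j: "2 \<le> j"
  then obtain n i where ni: "i < 2 ^ n" "j = Suc (2 ^ n + i)" using index_casesE[OF j] by metis
  have "(\<Sum>k<2^Suc n. if k = 2 * i then 1 else if k = 2 * i + 1 then - 1 else (0::real)) =
    (\<Sum>k<2^Suc n. (if k = 2 * i then 1 else 0) - (if k = 2 * i + 1 then 1 else 0))"
    by (rule sum.cong) auto
  also have "\<dots> = 0" using ni by (simp add: sum_subtractf)
  finally show ?thesis unfolding ni(2) haar_eq_stepf[OF ni(1)] integral_stepf by simp
qed

lemma fun_span_mono: "S \<subseteq> S' \<Longrightarrow> fun_span S \<subseteq> fun_span S'"
  by (auto simp: fun_span_def)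

lemma fun_span_haar_subset_Z: "fun_span (haar ` {2..}) \<subseteq> Z"
  unfolding Z_def by (rule fun_span_mono) auto

lemma integral_fun_span_haar: "f \<in> fun_span (haar ` {2..}) \<Longrightarrow> (\<integral>x. f x \<partial>U01) = 0"
proof (induction f rule: fun_span_induct)
  case (add g h c)
  have g: "integrable U01 g" "(\<integral>x. g x \<partial>U01) = 0"
    using add.hyps(1) integral_haar by (auto intro!: Z_integrable Z_haar)
  have h: "integrable U01 h"
    using add.hyps(2) fun_span_haar_subset_Z by (intro Z_integrable) auto
  show ?case using g h add.IH by simp
qed simp

locale faithful =
  fixes h :: "nat \<Rightarrow> real \<Rightarrow> real"
  assumes faithful_haar_system: "faithful_haar_system h"
begin

lemma h_values: "1 \<le> j \<Longrightarrow> h j x = 0 \<or> h j x = 1 \<or> h j x = - 1"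
  using faithful_haar_system unfolding faithful_haar_system_def by blast

lemma h_1: "h (Suc 0) = indicator {0..<1}"
  using faithful_haar_system unfolding faithful_haar_system_def by (simp add: haar_def)

lemma h_span: "2 \<le> j \<Longrightarrow> h j \<in> fun_span (haar ` {2..})"
  using faithful_haar_system unfolding faithful_haar_system_def by blast

lemma h_Z: "1 \<le> j \<Longrightarrow> h j \<in> Z"
proof (cases "j = 1")
  case True
  then show ?thesis using h_1 Z_haar[of 1] by (simp add: haar_def)
next
  case False
  assume "1 \<le> j"
  then show ?thesis using False h_span[of j] fun_span_haar_subset_Z by auto
qed

lemma integral_h: "2 \<le> j \<Longrightarrow> (\<integral>x. h j x \<partial>U01) = 0"
  by (rule integral_fun_span_haar[OF h_span])

lemma level_supp_0: "level_supp h 0 0 = {0..<1}"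
  using faithful_haar_system unfolding faithful_haar_system_def level_supp_def
  by (simp add: numeral_2_eq_2)

lemma support_pos: "2 \<le> k \<Longrightarrow> {x. h (2 * k - 1) x \<noteq> 0} = {x. h k x = 1}"
  and support_neg: "2 \<le> k \<Longrightarrow> {x. h (2 * k) x \<noteq> 0} = {x. h k x = - 1}"
  using faithful_haar_system unfolding faithful_haar_system_def by blast+

lemma level_supp_even: "level_supp h (Suc n) (2 * i) = {x. h (Suc (2 ^ n + i)) x = 1}"
  using support_pos[OF two_le_index[of n i]] unfolding level_supp_def dyadic_index_eqs(1) .

lemma level_supp_odd: "level_supp h (Suc n) (2 * i + 1) = {x. h (Suc (2 ^ n + i)) x = - 1}"
  using support_neg[OF two_le_index[of n i]] unfolding level_supp_def dyadic_index_eqs .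

lemma h_on_level_supp_Suc:
  assumes "x \<in> level_supp h (Suc n) i"
  shows "h (Suc (2 ^ n + i div 2)) x = (if even i then 1 else - 1)"
proof (cases "even i")
  case True
  then have "i = 2 * (i div 2)" by simp
  then show ?thesis using assms level_supp_even[of n "i div 2"] True by simp
next
  case False
  then have "i = 2 * (i div 2) + 1" by simp
  then show ?thesis using assms level_supp_odd[of n "i div 2"] False by simp
qed

lemma level_supp_Suc_subset: "level_supp h (Suc n) i \<subseteq> level_supp h n (i div 2)"
  using h_on_level_supp_Suc[of _ n i] by (auto simp: level_supp_def[of h n] split: if_splits)

lemma level_supp_split: "level_supp h n i = level_supp h (Suc n) (2 * i) \<union> level_supp h (Suc n) (2 * i + 1)"
  unfolding level_supp_even level_supp_odd using h_values[of "Suc (2 ^ n + i)"] by (auto simp: level_supp_def)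

lemma level_supp_disjoint: "i < 2 ^ n \<Longrightarrow> j < 2 ^ n \<Longrightarrow> x \<in> level_supp h n i \<Longrightarrow> x \<in> level_supp h n j \<Longrightarrow> i = j"
proof (induction n arbitrary: i j)
  case (Suc n)
  have d: "i div 2 = j div 2"
    using Suc.prems level_supp_Suc_subset[of n i] level_supp_Suc_subset[of n j] by (intro Suc.IH) auto
  have "(if even i then 1 else - 1 :: real) = (if even j then 1 else - 1)"
    using h_on_level_supp_Suc[OF Suc.prems(3)] h_on_level_supp_Suc[OF Suc.prems(4)] unfolding d by (rule trans[OF sym])
  then have "even i = even j" by (simp split: if_split_asm)
  then have "i mod 2 = j mod 2" by (simp add: mod2_eq_if)
  then show ?case using d div_mult_mod_eq[of i 2] div_mult_mod_eq[of j 2] by linarith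
qed auto

lemma level_supp_cover: "x \<in> {0..<1} \<Longrightarrow> \<exists>i<2^n. x \<in> level_supp h n i"
proof (induction n)
  case 0
  then show ?case using level_supp_0 by auto
next
  case (Suc n)
  then obtain i where i: "i < 2 ^ n" "x \<in> level_supp h n i" by blast
  then have "2 * i < 2 ^ Suc n" "2 * i + 1 < 2 ^ Suc n" by auto
  moreover have "x \<in> level_supp h (Suc n) (2 * i) \<or> x \<in> level_supp h (Suc n) (2 * i + 1)"
    using i(2) level_supp_split[of n i] by blast
  ultimately show ?case by blast
qed

lemma abs_h: "1 \<le> j \<Longrightarrow> \<bar>h j x\<bar> = indicator {x. h j x \<noteq> 0} x"
  using h_values[of j x] by (auto simp: indicator_def)

lemma support_in_Z: "1 \<le> j \<Longrightarrow> indicator {x. h j x \<noteq> 0} \<in> Z"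
  using Z_abs[OF h_Z] abs_h by simp

lemma level_supp_in_Z: "indicator (level_supp h n i) \<in> Z"
  unfolding level_supp_def by (rule support_in_Z) simp

lemma level_supp_subset: "level_supp h n i \<subseteq> {0..<1}"
  by (rule indicator_Z_subset[OF level_supp_in_Z])

lemma h_eq_indicators:
  "h (Suc (2 ^ n + i)) x = indicator (level_supp h (Suc n) (2 * i)) x - indicator (level_supp h (Suc n) (2 * i + 1)) x"
  unfolding level_supp_even level_supp_odd using h_values[of "Suc (2 ^ n + i)" x] by (auto simp: indicator_def)

lemma indicator_level_supp_split:
  "(indicator (level_supp h n i) x :: real) = indicator (level_supp h (Suc n) (2 * i)) x + indicator (level_supp h (Suc n) (2 * i + 1)) x"
  unfolding level_supp_even level_supp_odd using h_values[of "Suc (2 ^ n + i)" x] by (auto simp: indicator_def level_supp_def)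

text \<open>Every function of index at least \<open>2\<close> has mean zero, so its support is halved at each step.\<close>

lemma measure_level_supp: "i < 2 ^ n \<Longrightarrow> measure U01 (level_supp h n i) = 1 / 2 ^ n"
proof (induction n arbitrary: i)
  case 0
  then show ?case using level_supp_0 by (simp add: measure_def emeasure_U01)
next
  case (Suc n)
  define k where "k = i div 2"
  have k: "k < 2 ^ n" using Suc.prems by (auto simp: k_def)
  let ?a = "measure U01 (level_supp h (Suc n) (2 * k))" and ?b = "measure U01 (level_supp h (Suc n) (2 * k + 1))"
  have m: "(\<integral>x. indicator (level_supp h n i) x \<partial>U01) = measure U01 (level_supp h n i)" for n i
    by (rule integral_indicator_Z[OF level_supp_in_Z])
  have "?a + ?b = (\<integral>x. indicator (level_supp h n k) x \<partial>U01)"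
    unfolding indicator_level_supp_split[of n k]
    by (subst Bochner_Integration.integral_add) (simp_all only: m Z_integrable level_supp_in_Z)
  then have 1: "?a + ?b = 1 / 2 ^ n" using Suc.IH[OF k] m by simp
  have "?a - ?b = (\<integral>x. h (Suc (2 ^ n + k)) x \<partial>U01)"
    unfolding h_eq_indicators
    by (subst Bochner_Integration.integral_diff) (simp_all only: m Z_integrable level_supp_in_Z)
  then have "?a = ?b" using integral_h[OF two_le_index] by simp
  then have "?a = 1 / 2 ^ Suc n" "?b = 1 / 2 ^ Suc n" using 1 by auto
  moreover have "i = 2 * k \<or> i = 2 * k + 1" unfolding k_def by presburger
  ultimately show ?case by auto
qed

lemma equipartition_level_supp: "equipartition n (level_supp h n)"
proof -
  interpret finite_measure U01 by (rule finite_measure_U01)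
  have "level_supp h n i \<in> sets U01" for i by (rule indicator_Z_sets[OF level_supp_in_Z])
  moreover have "(\<Union>i<2^n. level_supp h n i) = {0..<1}"
    using level_supp_subset level_supp_cover by blast
  ultimately show ?thesis unfolding equipartition_def disjoint_family_on_def
    using level_supp_disjoint by (auto simp: emeasure_eq_measure measure_level_supp)
qed

lemma measure_support: "1 \<le> j \<Longrightarrow> measure U01 {x. h j x \<noteq> 0} = interval_len j"
proof (erule index_cases)
  assume "j = 1"
  moreover have "{x. h (Suc 0) x \<noteq> 0} = {0..<1}" by (auto simp: h_1 indicator_def)
  ultimately show ?thesis by (simp add: measure_def emeasure_U01)
next
  fix n i assume "i < 2 ^ n" "j = Suc (2 ^ n + i)"
  then show ?thesis using measure_level_supp[of i n] by (simp add: interval_len_Suc level_supp_def)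
qed

text \<open>At a point of \<open>[0,1)\<close> exactly one function of each level is nonzero, namely the one whose support
  contains the point, and its sign tells which child contains the point.\<close>

lemma partial_sum_on_level_supp:
  "i < 2 ^ n \<Longrightarrow> x \<in> level_supp h n i \<Longrightarrow> (\<Sum>j=1..2^n. c j * h j x) = tree_value c n i"
proof (induction n arbitrary: i)
  case 0
  then show ?case using level_supp_0 by (simp add: h_1)
next
  case (Suc n)
  let ?k = "i div 2"
  have k: "?k < 2 ^ n" "x \<in> level_supp h n ?k" using Suc.prems level_supp_Suc_subset by auto
  have zero: "h (Suc (2 ^ n + l)) x = 0" if l: "l < 2 ^ n" "l \<noteq> ?k" for l
  proof (rule ccontr)
    assume "h (Suc (2 ^ n + l)) x \<noteq> 0"
    then have "x \<in> level_supp h n l" by (simp add: level_supp_def)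
    then show False using level_supp_disjoint[OF l(1) k(1) _ k(2)] l(2) by simp
  qed
  have "(\<Sum>l<2^n. c (Suc (2 ^ n + l)) * h (Suc (2 ^ n + l)) x) =
    (\<Sum>l<2^n. if l = ?k then c (Suc (2 ^ n + l)) * h (Suc (2 ^ n + l)) x else 0)"
    using zero by (intro sum.cong) auto
  also have "\<dots> = c (Suc (2 ^ n + ?k)) * h (Suc (2 ^ n + ?k)) x" using k by simp
  finally show ?case
    unfolding sum_dyadic_levels using Suc.IH[OF k] h_on_level_supp_Suc[OF Suc.prems(2)] by simp
qed

lemma partial_sum_Z: "(\<lambda>x. \<Sum>j=1..2^n. c j * h j x) \<in> Z"
  by (intro Z_sum Z_scale h_Z) auto

text \<open>The partial sums of the expansion of \<open>f\<close> are its averages over the supports of level \<open>n\<close>: the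
  coefficient of a function is half the difference between the averages of \<open>f\<close> over the two children
  of its support.\<close>

lemma tree_value_haar_coef:
  assumes f: "f \<in> Z"
  shows "i < 2 ^ n \<Longrightarrow> tree_value (haar_coef h f) n i = 2 ^ n * (\<integral>x. f x * indicator (level_supp h n i) x \<partial>U01)"
proof (induction n arbitrary: i)
  case 0
  then show ?case by (simp add: haar_coef_def h_1 level_supp_0)
next
  case (Suc n)
  define k where "k = i div 2"
  have k: "k < 2 ^ n" using Suc.prems by (auto simp: k_def)
  let ?j = "Suc (2 ^ n + k)"
  let ?a = "\<integral>x. f x * indicator (level_supp h (Suc n) (2 * k)) x \<partial>U01"
  let ?b = "\<integral>x. f x * indicator (level_supp h (Suc n) (2 * k + 1)) x \<partial>U01"
  have int: "integrable U01 (\<lambda>x. f x * indicator (level_supp h n i) x)" for n i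
    by (intro Z_integrable Z_mult f level_supp_in_Z)
  have "(\<integral>x. f x * indicator (level_supp h n k) x \<partial>U01) = ?a + ?b"
    unfolding indicator_level_supp_split[of n k] distrib_left
    by (rule Bochner_Integration.integral_add[OF int int])
  then have 1: "tree_value (haar_coef h f) n k = 2 ^ n * (?a + ?b)" using Suc.IH[OF k] by simp
  have "(\<integral>x. f x * h ?j x \<partial>U01) = ?a - ?b"
    unfolding h_eq_indicators right_diff_distrib
    by (rule Bochner_Integration.integral_diff[OF int int])
  then have 2: "haar_coef h f ?j = 2 ^ n * (?a - ?b)" by (simp add: haar_coef_def interval_len_Suc[OF k])
  have "i = 2 * k \<or> i = 2 * k + 1" unfolding k_def by presburger
  then show ?case
  proof
    assume i: "i = 2 * k"
    then show ?thesis using 1 2 by (simp add: algebra_simps)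
  next
    assume i: "i = 2 * k + 1"
    then show ?thesis using 1 2 by (simp add: algebra_simps)
  qed
qed

text \<open>Either the two functions belong to the same level and have disjoint supports, or \<open>h i\<close> is constant
  on the support of \<open>h j\<close>, and \<open>h j\<close> has mean zero.\<close>

lemma orthogonal_less:
  assumes "1 \<le> i" "i < j"
  shows "(\<integral>x. h i x * h j x \<partial>U01) = 0"
proof -
  have "2 \<le> j" using assms by simp
  then obtain n k where k: "k < 2 ^ n" "j = Suc (2 ^ n + k)" by (rule index_casesE)
  show ?thesis
  proof (cases "i \<le> 2 ^ n")
    case True
    \<comment> \<open>The function \<open>h i\<close> is a partial sum with a single nonzero coefficient.\<close>
    define t where "t = tree_value (\<lambda>l. of_bool (l = i)) n k"
    have eq: "h i x * h j x = t * h j x" for x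
    proof (cases "x \<in> level_supp h n k")
      case x: True
      have "(\<Sum>l=1..2^n. of_bool (l = i) * h l x) = (\<Sum>l=1..2^n. if l = i then h l x else 0)"
        by (rule sum.cong) auto
      then have "t = h i x" using partial_sum_on_level_supp[OF k(1) x, of "\<lambda>l. of_bool (l = i)"] True assms(1)
        by (simp add: t_def)
      then show ?thesis by simp
    qed (simp add: level_supp_def k(2))
    show ?thesis unfolding eq using integral_h[OF \<open>2 \<le> j\<close>] by simp
  next
    case False
    define l where "l = i - Suc (2 ^ n)"
    have l: "i = Suc (2 ^ n + l)" "l < 2 ^ n" "l \<noteq> k" using False assms k by (auto simp: l_def)
    have eq: "h i x * h j x = 0" for x
      using level_supp_disjoint[OF l(2) k(1), of x] l(3) by (auto simp: level_supp_def l(1) k(2))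
    show ?thesis unfolding eq by simp
  qed
qed

lemma orthogonal:
  assumes "1 \<le> i" "1 \<le> j"
  shows "(\<integral>x. h i x * h j x \<partial>U01) = (if i = j then interval_len j else 0)"
proof -
  have "h j x * h j x = indicator {x. h j x \<noteq> 0} x" for x
    using h_values[OF assms(2), of x] by (auto simp: indicator_def)
  then have "(\<integral>x. h j x * h j x \<partial>U01) = interval_len j"
    using integral_indicator_Z[OF support_in_Z[OF assms(2)]] measure_support[OF assms(2)] by simp
  moreover have "i < j \<Longrightarrow> (\<integral>x. h i x * h j x \<partial>U01) = 0" using orthogonal_less[of i j] assms by simp
  moreover have "j < i \<Longrightarrow> (\<integral>x. h i x * h j x \<partial>U01) = 0"
    using orthogonal_less[of j i] assms by (simp add: mult.commute)
  ultimately show ?thesis by (cases i j rule: linorder_cases) auto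
qed

lemma haar_coef_self: "1 \<le> i \<Longrightarrow> 1 \<le> j \<Longrightarrow> haar_coef h (h i) j = of_bool (i = j)"
  using interval_len_pos[of j] by (auto simp: haar_coef_def orthogonal)

lemma integral_square_sum:
  assumes J: "finite J" "J \<subseteq> {1..}"
  shows "(\<integral>x. (\<Sum>j\<in>J. c j * h j x)\<^sup>2 \<partial>U01) = (\<Sum>j\<in>J. (c j)\<^sup>2 * interval_len j)"
proof -
  have hj: "1 \<le> j" if "j \<in> J" for j using that J by auto
  have "(\<integral>x. (\<Sum>j\<in>J. c j * h j x)\<^sup>2 \<partial>U01) =
      (\<integral>x. (\<Sum>i\<in>J. \<Sum>j\<in>J. c i * c j * (h i x * h j x)) \<partial>U01)"
    by (simp add: power2_eq_square sum_product mult_ac)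
  also have "\<dots> = (\<Sum>i\<in>J. \<integral>x. (\<Sum>j\<in>J. c i * c j * (h i x * h j x)) \<partial>U01)"
    by (intro Bochner_Integration.integral_sum Z_integrable Z_sum Z_scale Z_mult h_Z hj)
  also have "\<dots> = (\<Sum>i\<in>J. \<Sum>j\<in>J. c i * c j * (\<integral>x. h i x * h j x \<partial>U01))"
  proof (rule sum.cong[OF refl])
    fix i assume i: "i \<in> J"
    have "(\<integral>x. (\<Sum>j\<in>J. c i * c j * (h i x * h j x)) \<partial>U01) =
        (\<Sum>j\<in>J. \<integral>x. c i * c j * (h i x * h j x) \<partial>U01)"
      by (intro Bochner_Integration.integral_sum Z_integrable Z_scale Z_mult h_Z hj i)
    then show "(\<integral>x. (\<Sum>j\<in>J. c i * c j * (h i x * h j x)) \<partial>U01) =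
        (\<Sum>j\<in>J. c i * c j * (\<integral>x. h i x * h j x \<partial>U01))" by simp
  qed
  also have "\<dots> = (\<Sum>i\<in>J. \<Sum>j\<in>J. if i = j then (c j)\<^sup>2 * interval_len j else 0)"
    by (intro sum.cong refl) (simp add: orthogonal[OF hj hj] power2_eq_square)
  also have "\<dots> = (\<Sum>j\<in>J. (c j)\<^sup>2 * interval_len j)" using J(1) by simp
  finally show ?thesis .
qed

lemma expectation_bounded:
  assumes f: "f \<in> Z" and K: "\<And>x. \<bar>f x\<bar> \<le> K" and i: "i < 2 ^ n"
  shows "\<bar>tree_value (haar_coef h f) n i\<bar> \<le> K"
proof -
  have "\<bar>\<integral>x. f x * indicator (level_supp h n i) x \<partial>U01\<bar> \<le> (\<integral>x. \<bar>f x * indicator (level_supp h n i) x\<bar> \<partial>U01)"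
    by (rule integral_abs_bound)
  also have "\<dots> \<le> (\<integral>x. K * indicator (level_supp h n i) x \<partial>U01)"
    by (intro integral_mono Z_integrable Z_abs Z_scale Z_mult f level_supp_in_Z) (auto simp: indicator_def K)
  also have "\<dots> = K / 2 ^ n"
    using integral_indicator_Z[OF level_supp_in_Z] measure_level_supp[OF i] by simp
  finally show ?thesis by (simp add: tree_value_haar_coef[OF f i] abs_mult field_simps)
qed

end

lemma faithful_haar: "faithful haar"
proof
  have val: "haar j x \<in> {0, 1, -1}" if "1 \<le> j" for j x
    using that
  proof (cases j rule: index_cases)
    case 1
    then show ?thesis by (simp add: haar_def indicator_def)
  next
    case (2 n i)
    then show ?thesis by (simp add: haar_eq_stepf stepf_def)
  qed
  have supp: "{x. haar (Suc (2 ^ n + i)) x \<noteq> 0} = cellset n i"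
    and pos: "{x. haar (Suc (2 ^ n + i)) x = 1} = cellset (Suc n) (2 * i)"
    and neg: "{x. haar (Suc (2 ^ n + i)) x = -1} = cellset (Suc n) (2 * i + 1)" if "i < 2 ^ n" for n i
  proof -
    have "cell n x = cell (Suc n) x div 2" if "0 \<le> x" for x using cell_Suc_div[OF that] by simp
    then show "{x. haar (Suc (2 ^ n + i)) x \<noteq> 0} = cellset n i"
      by (auto simp: haar_eq_stepf[OF that] stepf_def cellset_def simp del: power_Suc)
    show "{x. haar (Suc (2 ^ n + i)) x = 1} = cellset (Suc n) (2 * i)"
      "{x. haar (Suc (2 ^ n + i)) x = -1} = cellset (Suc n) (2 * i + 1)"
      by (auto simp: haar_eq_stepf[OF that] stepf_def cellset_def simp del: power_Suc)
  qed
  have ch: "{x. haar (2 * k - 1) x \<noteq> 0} = {x. haar k x = 1} \<and> {x. haar (2 * k) x \<noteq> 0} = {x. haar k x = -1}"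
    if "2 \<le> k" for k
  proof -
    obtain n i where k: "i < 2 ^ n" "k = Suc (2 ^ n + i)" by (rule index_casesE[OF \<open>2 \<le> k\<close>])
    then have i2: "2 * i < 2 ^ Suc n" "2 * i + 1 < 2 ^ Suc n" by auto
    show ?thesis unfolding k(2) dyadic_index_eqs
      using supp[OF i2(1)] supp[OF i2(2)] pos[OF k(1)] neg[OF k(1)] by simp
  qed
  have "{x. haar 2 x \<noteq> 0} = {0..<1}"
  proof -
    have "Suc (2 ^ 0 + 0) = 2" by simp
    then have "{x. haar 2 x \<noteq> 0} = cellset 0 0" using supp[of 0 0] by (simp only:)
    also have "\<dots> = {0..<1}" using cell_0 by (auto simp: cellset_def)
    finally show ?thesis .
  qed
  moreover have span: "haar j \<in> fun_span (haar ` {2..})" if "2 \<le> j" for j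
    using that by (intro fun_span_superset imageI) simp
  ultimately show "faithful_haar_system haar"
    unfolding faithful_haar_system_def
    by (intro conjI allI impI refl) (assumption | rule val span conjunct1[OF ch] conjunct2[OF ch], assumption)+
qed

section \<open>Partial sums in a Haar system norm\<close>

lemma sum_greaterThanAtMost_eq_diff:
  fixes u :: "nat \<Rightarrow> real"
  assumes "a \<le> b"
  shows "(\<Sum>j\<in>{a<..b}. u j) = (\<Sum>j=1..b. u j) - (\<Sum>j=1..a. u j)"
proof -
  have "{1..b} = {1..a} \<union> {a<..b}" using assms by auto
  then have "(\<Sum>j=1..b. u j) = (\<Sum>j=1..a. u j) + (\<Sum>j\<in>{a<..b}. u j)"
    by (simp only:) (rule sum.union_disjoint; auto)
  then show ?thesis by simp
qed

context haar_norm
begin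

text \<open>Both sums have the value \<open>tree_value c n i\<close> on the support at position \<open>i\<close> of level \<open>n\<close>, and all these
  supports have measure \<open>2\<^sup>-\<^sup>n\<close>.\<close>

lemma N_transfer:
  assumes "faithful g" "faithful h"
  shows "N (\<lambda>x. \<Sum>j=1..2^n. c j * g j x) = N (\<lambda>x. \<Sum>j=1..2^n. c j * h j x)"
proof -
  interpret G: faithful g by fact
  interpret H: faithful h by fact
  show ?thesis
    by (rule N_equipartition[OF G.partial_sum_Z H.partial_sum_Z G.equipartition_level_supp H.equipartition_level_supp])
      (rule G.partial_sum_on_level_supp H.partial_sum_on_level_supp, assumption, assumption)+
qed

text \<open>The sum is the average of \<open>f\<close> over the supports of level \<open>n\<close>, and averaging is a contraction.\<close>

lemma N_expectation_le:
  assumes "faithful g" and f: "f \<in> Z"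
  shows "N (\<lambda>x. \<Sum>j=1..2^n. haar_coef g f j * g j x) \<le> N f"
proof -
  interpret G: faithful g by fact
  \<comment> \<open>The level sets of \<open>q\<close> are the supports of level \<open>n\<close>.\<close>
  define q where "q = (\<lambda>x. \<Sum>i<2^n. real i * indicator (level_supp g n i) x)"
  have q: "q x = real i" if "i < 2 ^ n" "x \<in> level_supp g n i" for i x
  proof -
    have "indicator (level_supp g n l) x = (if l = i then 1 else 0 :: real)" if "l < 2 ^ n" for l
      using G.level_supp_disjoint[OF that \<open>i < 2 ^ n\<close> _ \<open>x \<in> level_supp g n i\<close>] \<open>x \<in> level_supp g n i\<close>
      by (cases "l = i") (auto simp: indicator_def)
    then have "q x = (\<Sum>l<2^n. if l = i then real l else 0)"
      unfolding q_def by (intro sum.cong) auto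
    then show ?thesis using that by simp
  qed
  show ?thesis
  proof (rule N_averaging[OF f _ G.partial_sum_Z])
    show "q \<in> Z" unfolding q_def by (intro Z_sum Z_scale G.level_supp_in_Z)
    fix x :: real assume "x \<in> {0..<1}"
    then obtain i where i: "i < 2 ^ n" "x \<in> level_supp g n i" using G.level_supp_cover by blast
    have ind: "of_bool (q y = q x) = (indicator (level_supp g n i) y :: real)" if y: "y \<in> {0..<1}" for y
    proof -
      obtain l where l: "l < 2 ^ n" "y \<in> level_supp g n l" using G.level_supp_cover y by blast
      have "y \<in> level_supp g n i \<longleftrightarrow> l = i" using G.level_supp_disjoint[OF l(1) i(1) l(2)] l(2) by auto
      then show ?thesis using q[OF i] q[OF l] by (simp add: indicator_def)
    qed
    have 1: "(\<integral>y. of_bool (q y = q x) \<partial>U01) = (1::real) / 2 ^ n"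
    proof -
      have "(\<integral>y. of_bool (q y = q x) \<partial>U01) = (\<integral>y. indicator (level_supp g n i) y \<partial>U01 :: real)"
        by (rule Bochner_Integration.integral_cong[OF refl]) (simp only: space_U01 ind)
      then show ?thesis
        using integral_indicator_Z[OF G.level_supp_in_Z] G.measure_level_supp[OF i(1)] by simp
    qed
    have 2: "(\<integral>y. f y * of_bool (q y = q x) \<partial>U01) = (\<integral>y. f y * indicator (level_supp g n i) y \<partial>U01)"
      by (rule Bochner_Integration.integral_cong[OF refl]) (simp only: space_U01 ind)
    show "(\<Sum>j=1..2^n. haar_coef g f j * g j x) * (\<integral>y. of_bool (q y = q x) \<partial>U01) =
        (\<integral>y. f y * of_bool (q y = q x) \<partial>U01)"
      unfolding 1 2 G.partial_sum_on_level_supp[OF i] G.tree_value_haar_coef[OF f i(1)] by simp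
  qed
qed

lemma N_transport_le:
  assumes "faithful g" "faithful h" "f \<in> Z"
  shows "N (\<lambda>x. \<Sum>j=1..2^n. haar_coef g f j * h j x) \<le> N f"
  using N_transfer[OF assms(1,2), of "haar_coef g f" n] N_expectation_le[OF assms(1,3), of n] by simp

lemma indicator_initial_eq_stepf:
  assumes "c \<le> 2 ^ m"
  shows "indicator {0..<real c / 2 ^ m} = stepf m (\<lambda>k. of_bool (k < c))"
proof
  fix x :: real
  define d where "d = real c / 2 ^ m"
  have "d \<le> 1" unfolding d_def using assms by (simp add: divide_le_eq)
  moreover have "cell m x < c \<longleftrightarrow> x < d" if "0 \<le> x"
    using that by (auto simp: d_def cell_def nat_less_iff floor_less_iff field_simps)
  ultimately show "indicator {0..<real c / 2 ^ m} x = stepf m (\<lambda>k. of_bool (k < c)) x"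
    unfolding d_def[symmetric] by (auto simp: stepf_def indicator_def)
qed

lemma N_indicator_cong:
  assumes E: "indicator E \<in> Z" and F: "indicator F \<in> Z" and eq: "measure U01 E = measure U01 F"
  shows "N (indicator E) = N (indicator F)"
proof (rule N_eqI[OF E F])
  interpret finite_measure U01 by (rule finite_measure_U01)
  have *: "measure U01 {x\<in>{0..<1}. \<bar>indicator D x\<bar> \<in> A} =
      (if 1 \<in> A then measure U01 D else 0) + (if 0 \<in> A then measure U01 {0..<1} - measure U01 D else 0)"
    if D: "indicator D \<in> Z" for D :: "real set" and A :: "real set"
  proof -
    have sub: "D \<subseteq> {0..<1}" by (rule indicator_Z_subset[OF D])
    have Ds: "D \<in> sets U01" by (rule indicator_Z_sets[OF D])
    have Us: "{0..<1} \<in> sets U01" using sets.top[of U01] by (simp add: space_U01)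
    have "{x\<in>{0..<1}. \<bar>indicator D x\<bar> \<in> A} = (if 1 \<in> A then D else {}) \<union> (if 0 \<in> A then {0..<1} - D else {})"
      using sub by (auto simp: indicator_def)
    then have "measure U01 {x\<in>{0..<1}. \<bar>indicator D x\<bar> \<in> A} =
       measure U01 (if 1 \<in> A then D else {}) + measure U01 (if 0 \<in> A then {0..<1} - D else {})"
      using Ds Us by (simp only:) (rule finite_measure_Union; auto)
    also have "measure U01 ({0..<1} - D) = measure U01 {0..<1} - measure U01 D"
      by (rule finite_measure_Diff[OF Us Ds sub])
    then have "measure U01 (if 0 \<in> A then {0..<1} - D else {}) = (if 0 \<in> A then measure U01 {0..<1} - measure U01 D else 0)"
      by simp
    finally show ?thesis by simp
  qed
  fix A :: "real set"
  show "emeasure U01 {x\<in>{0..<1}. \<bar>indicator E x\<bar> \<in> A} = emeasure U01 {x\<in>{0..<1}. \<bar>indicator F x\<bar> \<in> A}"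
    unfolding emeasure_eq_measure *[OF E] *[OF F] eq ..
qed

text \<open>The fundamental function of the norm at \<open>2\<^sup>-\<^sup>k\<close>.\<close>

definition initial_norm :: "nat \<Rightarrow> real" where
  "initial_norm k = N (indicator {0..<1 / 2 ^ k})"

lemma initial_in_Z: "indicator {0..<1 / 2 ^ k} \<in> Z"
  using indicator_initial_eq_stepf[of 1 k] stepf_in_Z by simp

lemma N_indicator_le_initial:
  assumes E: "indicator E \<in> Z" and le: "measure U01 E \<le> 1 / 2 ^ k"
  shows "N (indicator E) \<le> initial_norm k"
proof -
  obtain m b where b: "indicator E = stepf m b" using Z_is_stepf[OF E] by blast
  define c where "c = card {k\<in>{..<2^m}. b k = 1}"
  have b01: "b k = 0 \<or> b k = 1" if "k < 2 ^ m" for k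
    using stepf_left_endpoint[OF that, of b] unfolding b[symmetric]
    by (cases "real k / 2 ^ m \<in> E") auto
  have "measure U01 E = (\<integral>x. indicator E x \<partial>U01)" by (rule integral_indicator_Z[OF E, symmetric])
  also have "\<dots> = (\<Sum>k<2^m. b k) / 2 ^ m" unfolding b by (rule integral_stepf)
  also have "(\<Sum>k<2^m. b k) = (\<Sum>k<2^m. if b k = 1 then 1 else 0)"
    using b01 by (intro sum.cong) auto
  also have "\<dots> = real c" by (simp add: c_def sum.If_cases Int_def)
  finally have mE: "measure U01 E = real c / 2 ^ m" .
  have cm: "c \<le> 2 ^ m"
    using card_mono[of "{..<2^m}" "{k\<in>{..<2^m}. b k = 1}"] by (auto simp: c_def)
  have F: "indicator {0..<real c / 2 ^ m} \<in> Z"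
    unfolding indicator_initial_eq_stepf[OF cm] by (rule stepf_in_Z)
  have "(\<integral>x. indicator {0..<real c / 2 ^ m} x \<partial>U01) = (\<Sum>k<2^m. of_bool (k < c)) / (2::real) ^ m"
    unfolding indicator_initial_eq_stepf[OF cm] by (rule integral_stepf)
  also have "(\<Sum>k<2^m. of_bool (k < c)) = (\<Sum>k<c. 1::real)"
    using cm by (intro sum.mono_neutral_cong_right) auto
  also have "(\<integral>x. indicator {0..<real c / 2 ^ m} x \<partial>U01) = measure U01 {0..<real c / 2 ^ m}"
    by (rule integral_indicator_Z[OF F])
  finally have "measure U01 {0..<real c / 2 ^ m} = measure U01 E" using mE by simp
  then have "N (indicator E) = N (indicator {0..<real c / 2 ^ m})"
    by (intro N_indicator_cong E F) simp
  also have "\<dots> \<le> initial_norm k" unfolding initial_norm_def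
    by (rule N_mono[OF F initial_in_Z]) (use le mE in \<open>auto simp: indicator_def\<close>)
  finally show ?thesis .
qed

text \<open>Chebyshev's inequality: outside a set of measure at most \<open>2\<^sup>-\<^sup>k\<close> the function is at most \<open>\<epsilon>\<close>, and
  on that set it is at most \<open>K\<close>.\<close>

lemma N_small:
  assumes g: "g \<in> Z" and K: "\<And>x. \<bar>g x\<bar> \<le> K" and \<epsilon>: "0 < \<epsilon>"
    and sq: "(\<integral>x. (g x)\<^sup>2 \<partial>U01) \<le> \<epsilon>\<^sup>2 / 2 ^ k"
  shows "N g \<le> \<epsilon> + K * initial_norm k"
proof -
  define E where "E = {x. \<bar>g x\<bar> > \<epsilon>}"
  have E: "indicator E \<in> Z"
  proof -
    have "(\<lambda>x. of_bool (\<bar>g x\<bar> > \<epsilon>)) \<in> Z" using \<epsilon> by (intro Z_map[OF g, of "\<lambda>t. of_bool (\<bar>t\<bar> > \<epsilon>)"]) auto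
    moreover have "(\<lambda>x. of_bool (\<bar>g x\<bar> > \<epsilon>)) = (indicator E :: real \<Rightarrow> real)"
      by (auto simp: E_def indicator_def)
    ultimately show ?thesis by simp
  qed
  have "\<epsilon>\<^sup>2 * measure U01 E = (\<integral>x. \<epsilon>\<^sup>2 * indicator E x \<partial>U01)"
    by (simp only: Bochner_Integration.integral_mult_right_zero integral_indicator_Z[OF E])
  also have "\<dots> \<le> (\<integral>x. (g x)\<^sup>2 \<partial>U01)"
  proof (intro integral_mono Z_integrable Z_scale E)
    show "(\<lambda>x. (g x)\<^sup>2) \<in> Z" by (rule Z_map[OF g]) simp
    fix x
    show "\<epsilon>\<^sup>2 * indicator E x \<le> (g x)\<^sup>2"
      using \<epsilon> abs_le_square_iff[of \<epsilon> "g x"] by (auto simp: E_def indicator_def)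
  qed
  also have "\<dots> \<le> \<epsilon>\<^sup>2 / 2 ^ k" by (rule sq)
  finally have "\<epsilon>\<^sup>2 * measure U01 E \<le> \<epsilon>\<^sup>2 * (1 / 2 ^ k)" by simp
  then have mE: "measure U01 E \<le> 1 / 2 ^ k"
    using \<epsilon> by (subst (asm) mult_le_cancel_left_pos) auto
  have K0: "0 \<le> K" using K[of 0] by linarith
  have iZ: "indicator {0..<1} \<in> Z" by (rule indicator_unit_in_Z)
  have "N g \<le> N (\<lambda>x. \<epsilon> * indicator {0..<1} x + K * indicator E x)"
  proof (rule N_mono[OF g Z_add[OF Z_scale[OF iZ] Z_scale[OF E]]])
    fix x
    show "\<bar>g x\<bar> \<le> \<bar>\<epsilon> * indicator {0..<1} x + K * indicator E x\<bar>"
    proof (cases "x \<in> E")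
      case True
      then have "x \<in> {0..<1}" using indicator_Z_subset[OF E] by blast
      then show ?thesis using True K[of x] K0 \<epsilon> by simp
    next
      case False
      then have "\<bar>g x\<bar> \<le> \<epsilon>" by (simp add: E_def)
      then show ?thesis using False Z_outside[OF g, of x] \<epsilon> by (cases "x \<in> {0..<1}") auto
    qed
  qed
  also have "\<dots> \<le> N (\<lambda>x. \<epsilon> * indicator {0..<1} x) + N (\<lambda>x. K * indicator E x)"
    by (rule N_triangle[OF Z_scale[OF iZ] Z_scale[OF E]])
  also have "\<dots> = \<epsilon> + K * N (indicator E)"
    using \<epsilon> K0 by (simp add: N_scale[OF iZ] N_scale[OF E] N_one)
  also have "\<dots> \<le> \<epsilon> + K * initial_norm k"
    using mult_left_mono[OF N_indicator_le_initial[OF E mE] K0] by simp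
  finally show ?thesis .
qed

text \<open>The partial sums take averages of \<open>f\<close> as values, so they are bounded by \<open>sup \<bar>f\<bar>\<close>. By orthogonality
  the squares of the coefficients are then summable, the tails are small in \<open>L\<^sub>2\<close>, and bounded functions
  that are small in \<open>L\<^sub>2\<close> have small norm.\<close>

lemma transport_Cauchy:
  assumes "faithful g" "faithful h" and f: "f \<in> Z" and initial_norm: "initial_norm \<longlonglongrightarrow> 0" and e: "0 < e"
  shows "\<exists>M. \<forall>m\<ge>M. \<forall>n\<ge>m. N (\<lambda>x. \<Sum>j\<in>{2^m<..2^n}. haar_coef g f j * h j x) < e"
proof -
  interpret G: faithful g by fact
  interpret H: faithful h by fact
  let ?c = "haar_coef g f"
  obtain K where K: "0 \<le> K" "\<And>x. \<bar>f x\<bar> \<le> K" using Z_bounded[OF f] by metis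
  define w where "w = (\<lambda>n x. \<Sum>j=1..2^n. ?c j * h j x)"
  have wZ: "w n \<in> Z" for n unfolding w_def by (rule H.partial_sum_Z)
  have wK: "\<bar>w n x\<bar> \<le> K" for n x
  proof (cases "x \<in> {0..<1}")
    case True
    then obtain i where i: "i < 2 ^ n" "x \<in> level_supp h n i" using H.level_supp_cover by blast
    show ?thesis unfolding w_def H.partial_sum_on_level_supp[OF i] by (rule G.expectation_bounded[OF f K(2) i(1)])
  qed (use K(1) Z_outside[OF wZ] in auto)
  \<comment> \<open>The squares of the \<open>L\<^sub>2\<close>-norms of the partial sums, which increase and are bounded by \<open>K\<^sup>2\<close>.\<close>
  define S where "S = (\<lambda>n::nat. \<Sum>j=1..2^n. (?c j)\<^sup>2 * interval_len j)"
  have S_eq: "S n = (\<integral>x. (w n x)\<^sup>2 \<partial>U01)" for n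
    unfolding S_def w_def by (rule H.integral_square_sum[symmetric]) auto
  have diff: "(\<Sum>j\<in>{2^m<..2^n}. u j) = (\<Sum>j=1..2^n. u j) - (\<Sum>j=1..2^m. u j)"
    if "m \<le> n" for m n and u :: "nat \<Rightarrow> real"
    by (rule sum_greaterThanAtMost_eq_diff) (use that in simp)
  have inc: "S m \<le> S n" if "m \<le> n" for m n
  proof -
    have "0 \<le> (\<Sum>j\<in>{2^m<..2^n}. (?c j)\<^sup>2 * interval_len j)"
      using interval_len_pos by (intro sum_nonneg mult_nonneg_nonneg) (auto intro: less_imp_le)
    then show ?thesis using diff[OF that] unfolding S_def by simp
  qed
  have "S n \<le> K\<^sup>2" for n
  proof -
    have iZ: "indicator {0..<1} \<in> Z" by (rule indicator_unit_in_Z)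
    have "S n \<le> (\<integral>x. K\<^sup>2 * indicator {0..<1} x \<partial>U01)"
      unfolding S_eq
    proof (intro integral_mono Z_integrable Z_scale iZ)
      show "(\<lambda>x. (w n x)\<^sup>2) \<in> Z" by (rule Z_map[OF wZ]) simp
      fix x assume "x \<in> space U01"
      then show "(w n x)\<^sup>2 \<le> K\<^sup>2 * indicator {0..<1} x"
        using wK[of n x] K(1) by (simp add: space_U01 abs_le_square_iff[symmetric])
    qed
    also have "\<dots> = K\<^sup>2" by (simp add: space_U01 measure_def emeasure_U01)
    finally show ?thesis .
  qed
  then have "Cauchy S"
    using inc by (intro convergent_Cauchy Bseq_monoseq_convergent BseqI'[of _ "K\<^sup>2"])
      (auto simp: monoseq_def S_eq)
  \<comment> \<open>\<open>2 K + 1\<close> instead of \<open>2 K\<close>, since \<open>K\<close> may be zero.\<close>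
  have "\<forall>\<^sub>F k in sequentially. norm (initial_norm k) < e / 2 / (2 * K + 1)"
    using initial_norm e K(1) by (auto simp: tendsto_iff dist_norm)
  then obtain k where k: "\<bar>initial_norm k\<bar> < e / 2 / (2 * K + 1)"
    by (auto simp: eventually_sequentially)
  have "0 \<le> initial_norm k" unfolding initial_norm_def by (rule N_nonneg[OF initial_in_Z])
  then have "2 * K * initial_norm k \<le> (2 * K + 1) * initial_norm k" using K(1) by (simp add: algebra_simps)
  also have "\<dots> < e / 2" using k K(1) \<open>0 \<le> initial_norm k\<close> by (simp add: field_simps)
  finally have k': "2 * K * initial_norm k < e / 2" .
  have "0 < (e / 2)\<^sup>2 / 2 ^ k" using e by simp
  then obtain M where M: "\<And>m n. m \<ge> M \<Longrightarrow> n \<ge> M \<Longrightarrow> norm (S m - S n) < (e / 2)\<^sup>2 / 2 ^ k"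
    using CauchyD[OF \<open>Cauchy S\<close>] by metis
  show ?thesis
  proof (intro exI allI impI)
    fix m n assume mn: "M \<le> m" "m \<le> n"
    let ?d = "\<lambda>x. \<Sum>j\<in>{2^m<..2^n}. ?c j * h j x"
    have dw: "?d x = w n x - w m x" for x unfolding w_def by (rule diff[OF mn(2)])
    have "N ?d \<le> e / 2 + 2 * K * initial_norm k"
    proof (rule N_small)
      show "?d \<in> Z" unfolding dw by (rule Z_diff[OF wZ wZ])
      show "\<bar>?d x\<bar> \<le> 2 * K" for x unfolding dw using wK[of n x] wK[of m x] by linarith
      have "(\<integral>x. (?d x)\<^sup>2 \<partial>U01) = (\<Sum>j\<in>{2^m<..2^n}. (?c j)\<^sup>2 * interval_len j)"
        by (rule H.integral_square_sum) auto
      also have "\<dots> = S n - S m" unfolding S_def by (rule diff[OF mn(2)])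
      also have "\<dots> \<le> (e / 2)\<^sup>2 / 2 ^ k" using M[of n m] mn by simp
      finally show "(\<integral>x. (?d x)\<^sup>2 \<partial>U01) \<le> (e / 2)\<^sup>2 / 2 ^ k" .
    qed (use e in simp)
    then show "N ?d < e" using k' by simp
  qed
qed

end

section \<open>The completion and the duality pairing\<close>

locale haar_space =
  fixes N :: "(real \<Rightarrow> real) \<Rightarrow> real" and emb :: "(real \<Rightarrow> real) \<Rightarrow> 'f::banach"
  assumes haar_system_space: "haar_system_space N emb"

sublocale haar_space \<subseteq> haar_norm N
  using haar_system_space by unfold_locales (simp add: haar_system_space_def)

context haar_space
begin

lemma emb_add: "f \<in> Z \<Longrightarrow> g \<in> Z \<Longrightarrow> emb (\<lambda>x. f x + g x) = emb f + emb g"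
  and emb_scale: "f \<in> Z \<Longrightarrow> emb (\<lambda>x. c * f x) = c *\<^sub>R emb f"
  and norm_emb: "f \<in> Z \<Longrightarrow> norm (emb f) = N f"
  and emb_dense: "closure (emb ` Z) = UNIV"
  using haar_system_space unfolding haar_system_space_def by blast+

lemma emb_diff:
  assumes "f \<in> Z" "g \<in> Z"
  shows "emb (\<lambda>x. f x - g x) = emb f - emb g"
  using emb_add[OF assms(1) Z_scale[OF assms(2)], of "- 1"] emb_scale[OF assms(2), of "- 1"] by simp

lemma emb_zero: "emb (\<lambda>x. 0) = 0"
  using emb_scale[OF Z_zero, of 0] by simp

lemma emb_sum: "(\<And>k. k \<in> I \<Longrightarrow> F k \<in> Z) \<Longrightarrow> emb (\<lambda>x. \<Sum>k\<in>I. F k x) = (\<Sum>k\<in>I. emb (F k))"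
proof (induction I rule: infinite_finite_induct)
  case (insert k I)
  then have "emb (\<lambda>x. F k x + (\<Sum>k\<in>I. F k x)) = emb (F k) + emb (\<lambda>x. \<Sum>k\<in>I. F k x)"
    by (intro emb_add Z_sum) auto
  then show ?case using insert by simp
qed (auto simp: emb_zero)

text \<open>The geometric rate makes the increments of the sequence absolutely summable.\<close>

lemma approximation:
  obtains z :: "nat \<Rightarrow> real \<Rightarrow> real"
  where "\<And>n. z n \<in> Z" "\<And>n. norm (emb (z n) - u) < 1 / 2 ^ n" "(\<lambda>n. emb (z n)) \<longlonglongrightarrow> u"
proof -
  have "\<exists>f\<in>Z. norm (emb f - u) < 1 / 2 ^ n" for n
  proof -
    have "u \<in> closure (emb ` Z)" using emb_dense by simp
    then have "\<exists>y\<in>emb ` Z. dist y u < 1 / 2 ^ n" by (simp add: closure_approachable)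
    then show ?thesis by (auto simp: dist_norm)
  qed
  then obtain z where z: "\<And>n. z n \<in> Z" "\<And>n. norm (emb (z n) - u) < 1 / 2 ^ n" by metis
  have "(\<lambda>n. 1 / 2 ^ n :: real) \<longlonglongrightarrow> 0" using LIMSEQ_realpow_zero[of "1/2::real"] by (simp add: power_one_over)
  then have "(\<lambda>n. emb (z n) - u) \<longlonglongrightarrow> 0"
    by (rule Lim_null_comparison[rotated]) (use z(2) in \<open>auto intro!: always_eventually less_imp_le\<close>)
  then have "(\<lambda>n. emb (z n)) \<longlonglongrightarrow> u" by (simp add: LIM_zero_iff)
  then show ?thesis using that z by blast
qed

lemma dense_norm_le:
  fixes Q :: "'f \<Rightarrow> 'c::real_normed_vector"
  assumes Q: "bounded_linear Q" and le: "\<And>f. f \<in> Z \<Longrightarrow> norm (Q (emb f)) \<le> C * N f"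
  shows "norm (Q u) \<le> C * norm u"
proof -
  obtain z where z: "\<And>n. z n \<in> Z" "(\<lambda>n. emb (z n)) \<longlonglongrightarrow> u" using approximation by metis
  have "(\<lambda>n. norm (Q (emb (z n)))) \<longlonglongrightarrow> norm (Q u)"
    by (intro tendsto_norm bounded_linear.tendsto[OF Q] z)
  moreover have "(\<lambda>n. C * norm (emb (z n))) \<longlonglongrightarrow> C * norm u"
    by (intro tendsto_intros z)
  ultimately show ?thesis
    by (rule LIMSEQ_le) (use le z(1) norm_emb in auto)
qed

text \<open>The uniform bound carries convergence from the dense subspace over to the whole space.\<close>

lemma pointwise_limit_operator:
  fixes A :: "nat \<Rightarrow> 'f \<Rightarrow> 'c::banach"
  assumes A: "\<And>n. bounded_linear (A n)" and C: "\<And>n u. norm (A n u) \<le> C * norm u" and C0: "0 \<le> C"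
    and conv: "\<And>f. f \<in> Z \<Longrightarrow> convergent (\<lambda>n. A n (emb f))"
  shows "\<exists>Q. bounded_linear Q \<and> (\<forall>u. norm (Q u) \<le> C * norm u) \<and> (\<forall>u. (\<lambda>n. A n u) \<longlonglongrightarrow> Q u)"
proof -
  have "Cauchy (\<lambda>n. A n u)" for u
  proof (rule CauchyI)
    fix e :: real assume e: "0 < e"
    \<comment> \<open>\<open>C + 1\<close> instead of \<open>C\<close>, since \<open>C\<close> may be zero.\<close>
    define \<epsilon> where "\<epsilon> = e / 3 / (C + 1)"
    have \<epsilon>: "0 < \<epsilon>" "C * \<epsilon> < e / 3" using e C0 by (auto simp: \<epsilon>_def field_simps)
    obtain z where z: "\<And>n. z n \<in> Z" "(\<lambda>n. emb (z n)) \<longlonglongrightarrow> u" using approximation by metis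
    then obtain k where k: "norm (emb (z k) - u) < \<epsilon>"
      using LIMSEQ_D[OF z(2) \<epsilon>(1)] by blast
    have d: "norm (A n (emb (z k)) - A n u) < e / 3" for n
    proof -
      have "norm (A n (emb (z k)) - A n u) = norm (A n (emb (z k) - u))"
        using bounded_linear.linear[OF A] by (simp add: linear_diff)
      also have "\<dots> \<le> C * norm (emb (z k) - u)" by (rule C)
      also have "\<dots> \<le> C * \<epsilon>" using k C0 by (intro mult_left_mono) auto
      finally show ?thesis using \<epsilon> by simp
    qed
    obtain M where M: "\<And>m n. m \<ge> M \<Longrightarrow> n \<ge> M \<Longrightarrow> norm (A m (emb (z k)) - A n (emb (z k))) < e / 3"
      using CauchyD[OF convergent_Cauchy[OF conv[OF z(1)[of k]]], of "e / 3"] e by auto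
    have "norm (A m u - A n u) < e" if "m \<ge> M" "n \<ge> M" for m n
    proof -
      have "dist (A m u) (A m (emb (z k))) < e / 3"
        using d[of m] unfolding dist_norm by (subst norm_minus_commute)
      moreover have "dist (A m (emb (z k))) (A n (emb (z k))) < e / 3"
        using M[OF that] unfolding dist_norm .
      moreover have "dist (A n (emb (z k))) (A n u) < e / 3"
        using d[of n] unfolding dist_norm .
      ultimately show ?thesis using dist_triangle_third unfolding dist_norm[symmetric] by blast
    qed
    then show "\<exists>M. \<forall>m\<ge>M. \<forall>n\<ge>M. norm (A m u - A n u) < e" by blast
  qed
  then have "convergent (\<lambda>n. A n u)" for u by (rule Cauchy_convergent)
  then have Q: "(\<lambda>n. A n u) \<longlonglongrightarrow> lim (\<lambda>n. A n u)" for u by (simp only: convergent_LIMSEQ_iff)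
  define Q where "Q u = lim (\<lambda>n. A n u)" for u
  note Q = Q[folded Q_def]
  have lin: "linear (A n)" for n by (rule bounded_linear.linear[OF A])
  have bound: "norm (Q u) \<le> C * norm u" for u
    by (rule LIMSEQ_le_const2[OF tendsto_norm[OF Q]]) (use C in auto)
  have "bounded_linear Q"
  proof (rule bounded_linear_intro)
    show "Q (u + v) = Q u + Q v" for u v
    proof (rule LIMSEQ_unique[OF Q])
      show "(\<lambda>n. A n (u + v)) \<longlonglongrightarrow> Q u + Q v"
        using tendsto_add[OF Q[of u] Q[of v]] by (simp add: linear_add[OF lin])
    qed
    show "Q (c *\<^sub>R u) = c *\<^sub>R Q u" for c u
    proof (rule LIMSEQ_unique[OF Q])
      show "(\<lambda>n. A n (c *\<^sub>R u)) \<longlonglongrightarrow> c *\<^sub>R Q u"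
        using tendsto_scaleR[OF tendsto_const[of c] Q[of u]] by (simp add: linear_scale[OF lin])
    qed
    show "norm (Q u) \<le> norm u * C" for u using bound[of u] by (simp add: mult.commute)
  qed
  then show ?thesis using bound Q by blast
qed

lemma L1_diff_le:
  assumes "f \<in> Z" "g \<in> Z"
  shows "(\<integral>x. \<bar>f x - g x\<bar> \<partial>U01) \<le> norm (emb f - emb g)"
  using L1_le_N[OF Z_diff[OF assms]] norm_emb[OF Z_diff[OF assms]] emb_diff[OF assms] by simp

text \<open>Take a sequence in \<open>Z\<close> that converges to \<open>u\<close> at a geometric rate. Since the norm dominates the norm
  of \<open>L\<^sub>1\<close>, its increments form a series that converges absolutely almost everywhere and in \<open>L\<^sub>1\<close>. Any other
  sequence that converges to \<open>u\<close> is close to this one in \<open>L\<^sub>1\<close>.\<close>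

lemma fun_of_exists:
  "\<exists>f. integrable U01 f \<and>
     (\<forall>z :: nat \<Rightarrow> real \<Rightarrow> real. (\<forall>n. z n \<in> Z) \<and> (\<lambda>n. emb (z n)) \<longlonglongrightarrow> u \<longrightarrow>
        (\<lambda>n. \<integral>x. \<bar>z n x - f x\<bar> \<partial>U01) \<longlonglongrightarrow> 0)"
proof -
  obtain z where z: "\<And>n. z n \<in> Z" "\<And>n. norm (emb (z n) - u) < 1 / 2 ^ n" "(\<lambda>n. emb (z n)) \<longlonglongrightarrow> u"
    using approximation by metis
  define d where "d = (\<lambda>n x. z (Suc n) x - z n x)"
  have dZ: "d n \<in> Z" for n unfolding d_def by (rule Z_diff[OF z(1) z(1)])
  have dI: "integrable U01 (\<lambda>x. \<bar>d n x\<bar>)" for n by (rule Z_integrable[OF Z_abs[OF dZ]])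
  have dn: "(\<integral>x. \<bar>d n x\<bar> \<partial>U01) \<le> 2 * (1 / 2) ^ n" for n
  proof -
    have "(\<integral>x. \<bar>d n x\<bar> \<partial>U01) \<le> norm (emb (z (Suc n)) - emb (z n))"
      unfolding d_def by (rule L1_diff_le[OF z(1) z(1)])
    also have "\<dots> \<le> 1 / 2 ^ Suc n + 1 / 2 ^ n"
      using z(2)[of n] z(2)[of "Suc n"]
        norm_triangle_ineq4[of "emb (z (Suc n)) - u" "emb (z n) - u"] by simp
    also have "\<dots> \<le> 2 * (1 / 2) ^ n" by (simp add: power_one_over field_simps)
    finally show ?thesis .
  qed
  have geo: "summable (\<lambda>n. 2 * (1 / 2) ^ n :: real)" by (intro summable_mult summable_geometric) simp
  have sumI: "summable (\<lambda>n. \<integral>x. norm (d n x) \<partial>U01)"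
    by (rule summable_comparison_test'[OF geo, of 0]) (use dn in auto)
  have AE_sum: "AE x in U01. summable (\<lambda>n. norm (d n x))"
  proof -
    have meas: "(\<lambda>x. ennreal (norm (d n x))) \<in> borel_measurable U01" for n
      using dI[of n] by auto
    have "(\<integral>\<^sup>+x. (\<Sum>n. ennreal (norm (d n x))) \<partial>U01) = (\<Sum>n. \<integral>\<^sup>+x. ennreal (norm (d n x)) \<partial>U01)"
      by (rule nn_integral_suminf[OF meas])
    also have "\<dots> = (\<Sum>n. ennreal (\<integral>x. norm (d n x) \<partial>U01))"
      using dI by (intro suminf_cong nn_integral_eq_integral) auto
    also have "\<dots> = ennreal (\<Sum>n. \<integral>x. norm (d n x) \<partial>U01)"
      by (rule suminf_ennreal2[OF _ sumI]) simp
    finally have "(\<integral>\<^sup>+x. (\<Sum>n. ennreal (norm (d n x))) \<partial>U01) \<noteq> \<infinity>" by simp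
    then have "AE x in U01. (\<Sum>n. ennreal (norm (d n x))) \<noteq> \<infinity>"
      using meas by (intro nn_integral_noteq_infinite) auto
    then show ?thesis
      by eventually_elim (rule summable_suminf_not_top, auto)
  qed
  define F where "F = (\<lambda>x. z 0 x + (\<Sum>n. d n x))"
  have dI': "integrable U01 (d n)" for n by (rule Z_integrable[OF dZ])
  have FI: "integrable U01 F" unfolding F_def
    by (intro Bochner_Integration.integrable_add Z_integrable z integrable_suminf dI' AE_sum sumI)
  define w where "w = (\<lambda>x. \<Sum>n. norm (d n x))"
  have wI: "integrable U01 w" unfolding w_def
    by (rule integrable_suminf) (use AE_sum sumI dI' in auto)
  have tel: "z n x = z 0 x + (\<Sum>k<n. d k x)" for n x
    unfolding d_def by (subst sum_lessThan_telescope) simp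
  have "(\<lambda>n. \<integral>x. \<bar>z n x - F x\<bar> \<partial>U01) \<longlonglongrightarrow> (\<integral>x. 0 \<partial>U01)"
  proof (rule integral_dominated_convergence[where w = w])
    show "(\<lambda>x. \<bar>z n x - F x\<bar>) \<in> borel_measurable U01" for n
      using FI Z_integrable[OF z(1)[of n]] by auto
    show "AE x in U01. (\<lambda>n. \<bar>z n x - F x\<bar>) \<longlonglongrightarrow> 0"
      using AE_sum
    proof eventually_elim
      case (elim x)
      then have "summable (\<lambda>n. d n x)" by (rule summable_norm_cancel)
      then have "(\<lambda>n. \<Sum>k<n. d k x) \<longlonglongrightarrow> (\<Sum>k. d k x)" by (rule summable_LIMSEQ)
      then have "(\<lambda>n. z 0 x + (\<Sum>k<n. d k x)) \<longlonglongrightarrow> F x"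
        unfolding F_def by (intro tendsto_add tendsto_const)
      then have "(\<lambda>n. z n x) \<longlonglongrightarrow> F x" by (simp only: tel[symmetric])
      then show ?case by (simp add: tendsto_rabs_zero_iff LIM_zero_iff)
    qed
    show "AE x in U01. norm \<bar>z n x - F x\<bar> \<le> w x" for n
      using AE_sum
    proof eventually_elim
      case (elim x)
      then have s: "summable (\<lambda>n. d n x)" by (rule summable_norm_cancel)
      have "(\<Sum>k. d (k + n) x) = (\<Sum>k. d k x) - (\<Sum>k<n. d k x)"
        by (rule suminf_minus_initial_segment[OF s])
      then have "\<bar>z n x - F x\<bar> = \<bar>\<Sum>k. d (k + n) x\<bar>"
        unfolding F_def tel[of n x] by simp
      also have "\<dots> \<le> (\<Sum>k. norm (d (k + n) x))"
        using summable_norm[OF summable_ignore_initial_segment[OF elim, of n]] by simp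
      also have "\<dots> = w x - (\<Sum>k<n. norm (d k x))"
        unfolding w_def by (rule suminf_minus_initial_segment[OF elim])
      also have "\<dots> \<le> w x" by (simp add: sum_nonneg)
      finally show ?case by simp
    qed
  qed (use wI in auto)
  then have zF: "(\<lambda>n. \<integral>x. \<bar>z n x - F x\<bar> \<partial>U01) \<longlonglongrightarrow> 0" by simp
  have "(\<lambda>n. \<integral>x. \<bar>y n x - F x\<bar> \<partial>U01) \<longlonglongrightarrow> 0"
    if y: "\<And>n. y n \<in> Z" "(\<lambda>n. emb (y n)) \<longlonglongrightarrow> u" for y :: "nat \<Rightarrow> real \<Rightarrow> real"
  proof (rule tendsto_sandwich[OF _ _ tendsto_const])
    show "\<forall>\<^sub>F n in sequentially. 0 \<le> (\<integral>x. \<bar>y n x - F x\<bar> \<partial>U01)" by simp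
    have "(\<integral>x. \<bar>y n x - F x\<bar> \<partial>U01) \<le> norm (emb (y n) - emb (z n)) + (\<integral>x. \<bar>z n x - F x\<bar> \<partial>U01)" for n
    proof -
      have I: "integrable U01 (\<lambda>x. \<bar>y n x - z n x\<bar>)" "integrable U01 (\<lambda>x. \<bar>z n x - F x\<bar>)"
        "integrable U01 (\<lambda>x. \<bar>y n x - F x\<bar>)"
        using FI Z_integrable[OF z(1)[of n]] Z_integrable[OF y(1)[of n]] by auto
      have "(\<integral>x. \<bar>y n x - F x\<bar> \<partial>U01) \<le> (\<integral>x. \<bar>y n x - z n x\<bar> + \<bar>z n x - F x\<bar> \<partial>U01)"
        using I by (intro integral_mono) auto
      also have "\<dots> = (\<integral>x. \<bar>y n x - z n x\<bar> \<partial>U01) + (\<integral>x. \<bar>z n x - F x\<bar> \<partial>U01)"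
        using I by (intro Bochner_Integration.integral_add)
      finally show ?thesis using L1_diff_le[OF y(1)[of n] z(1)[of n]] by simp
    qed
    then show "\<forall>\<^sub>F n in sequentially. (\<integral>x. \<bar>y n x - F x\<bar> \<partial>U01)
        \<le> norm (emb (y n) - emb (z n)) + (\<integral>x. \<bar>z n x - F x\<bar> \<partial>U01)" by simp
    show "(\<lambda>n. norm (emb (y n) - emb (z n)) + (\<integral>x. \<bar>z n x - F x\<bar> \<partial>U01)) \<longlonglongrightarrow> 0"
      using tendsto_add[OF tendsto_norm[OF tendsto_diff[OF y(2) z(3)]] zF] by simp
  qed
  then show ?thesis using FI by blast
qed

lemma integrable_fun_of: "integrable U01 (fun_of emb u)"
  and fun_of_LIMSEQ: "\<lbrakk>\<And>n. z n \<in> Z; (\<lambda>n. emb (z n)) \<longlonglongrightarrow> u\<rbrakk> \<Longrightarrow>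
    (\<lambda>n. \<integral>x. \<bar>z n x - fun_of emb u x\<bar> \<partial>U01) \<longlonglongrightarrow> 0"
  using someI_ex[OF fun_of_exists[of u]] unfolding fun_of_def[symmetric] by blast+

text \<open>For \<open>g\<close> in \<open>Z\<close>, which is bounded, the pairing is thereby the continuous extension of
  \<open>f \<mapsto> \<integral> f g\<close> from \<open>Z\<close>; its linearity and boundedness are inherited from there.\<close>

lemma pairing_LIMSEQ:
  assumes g: "g \<in> Z" and z: "\<And>n. z n \<in> Z" "(\<lambda>n. emb (z n)) \<longlonglongrightarrow> u"
  shows "(\<lambda>n. \<integral>x. z n x * g x \<partial>U01) \<longlonglongrightarrow> pairing emb u g"
proof -
  obtain K where K: "0 \<le> K" "\<And>x. \<bar>g x\<bar> \<le> K" using Z_bounded[OF g] by metis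
  let ?F = "fun_of emb u"
  have FI: "integrable U01 ?F" by (rule integrable_fun_of)
  have gm: "g \<in> borel_measurable U01" using Z_integrable[OF g] by auto
  have FgI: "integrable U01 (\<lambda>x. ?F x * g x)"
  proof (rule Bochner_Integration.integrable_bound)
    show "integrable U01 (\<lambda>x. K * ?F x)" using FI by simp
    show "(\<lambda>x. ?F x * g x) \<in> borel_measurable U01" using FI gm by simp
    show "AE x in U01. norm (?F x * g x) \<le> norm (K * ?F x)"
      using K by (auto simp: abs_mult mult.commute[of K] intro!: mult_left_mono)
  qed
  have "(\<lambda>n. (\<integral>x. z n x * g x \<partial>U01) - pairing emb u g) \<longlonglongrightarrow> 0"
  proof (rule Lim_null_comparison)
    have "norm ((\<integral>x. z n x * g x \<partial>U01) - pairing emb u g) \<le> K * (\<integral>x. \<bar>z n x - ?F x\<bar> \<partial>U01)" for n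
    proof -
      have zg: "integrable U01 (\<lambda>x. z n x * g x)" by (rule Z_integrable[OF Z_mult[OF z(1) g]])
      have zF: "integrable U01 (\<lambda>x. z n x - ?F x)" using FI Z_integrable[OF z(1)] by simp
      have "(\<integral>x. z n x * g x \<partial>U01) - pairing emb u g = (\<integral>x. z n x * g x - ?F x * g x \<partial>U01)"
        unfolding pairing_def by (rule Bochner_Integration.integral_diff[OF zg FgI, symmetric])
      also have "\<bar>\<dots>\<bar> \<le> (\<integral>x. \<bar>z n x * g x - ?F x * g x\<bar> \<partial>U01)" by (rule integral_abs_bound)
      also have "\<dots> \<le> (\<integral>x. K * \<bar>z n x - ?F x\<bar> \<partial>U01)"
      proof (rule integral_mono)
        show "integrable U01 (\<lambda>x. \<bar>z n x * g x - ?F x * g x\<bar>)" using zg FgI by simp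
        show "integrable U01 (\<lambda>x. K * \<bar>z n x - ?F x\<bar>)" using zF by simp
        fix x
        have "\<bar>z n x * g x - ?F x * g x\<bar> = \<bar>z n x - ?F x\<bar> * \<bar>g x\<bar>"
          by (simp add: left_diff_distrib[symmetric] abs_mult)
        then show "\<bar>z n x * g x - ?F x * g x\<bar> \<le> K * \<bar>z n x - ?F x\<bar>"
          using mult_left_mono[OF K(2)[of x], of "\<bar>z n x - ?F x\<bar>"] by (simp add: mult.commute)
      qed
      finally show ?thesis by simp
    qed
    then show "\<forall>\<^sub>F n in sequentially. norm ((\<integral>x. z n x * g x \<partial>U01) - pairing emb u g)
        \<le> K * (\<integral>x. \<bar>z n x - ?F x\<bar> \<partial>U01)" by simp
    show "(\<lambda>n. K * (\<integral>x. \<bar>z n x - ?F x\<bar> \<partial>U01)) \<longlonglongrightarrow> 0"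
      using tendsto_mult_right_zero[OF fun_of_LIMSEQ[OF z]] .
  qed
  then show ?thesis by (simp add: LIM_zero_iff)
qed

lemma pairing_emb:
  assumes "f \<in> Z" "g \<in> Z"
  shows "pairing emb (emb f) g = (\<integral>x. f x * g x \<partial>U01)"
  by (rule LIMSEQ_unique[OF pairing_LIMSEQ[OF assms(2)]]) (use assms in auto)

lemma bounded_linear_pairing:
  assumes g: "g \<in> Z"
  shows "bounded_linear (\<lambda>u. pairing emb u g)"
proof -
  obtain K where K: "0 \<le> K" "\<And>x. \<bar>g x\<bar> \<le> K" using Z_bounded[OF g] by metis
  show ?thesis
  proof (rule bounded_linear_intro)
    fix u v c
    obtain y where y: "\<And>n. y n \<in> Z" "(\<lambda>n. emb (y n)) \<longlonglongrightarrow> u" using approximation by metis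
    obtain z where z: "\<And>n. z n \<in> Z" "(\<lambda>n. emb (z n)) \<longlonglongrightarrow> v" using approximation by metis
    note yg = pairing_LIMSEQ[OF g y] and zg = pairing_LIMSEQ[OF g z]
    have I: "integrable U01 (\<lambda>x. y n x * g x)" "integrable U01 (\<lambda>x. z n x * g x)" for n
      using Z_integrable[OF Z_mult[OF y(1) g]] Z_integrable[OF Z_mult[OF z(1) g]] by auto
    have "(\<lambda>n. emb (\<lambda>x. y n x + z n x)) \<longlonglongrightarrow> u + v"
      using tendsto_add[OF y(2) z(2)] by (simp add: emb_add y z)
    then have "(\<lambda>n. \<integral>x. (y n x + z n x) * g x \<partial>U01) \<longlonglongrightarrow> pairing emb (u + v) g"
      by (intro pairing_LIMSEQ g Z_add y z)
    moreover have "(\<integral>x. (y n x + z n x) * g x \<partial>U01) = (\<integral>x. y n x * g x \<partial>U01) + (\<integral>x. z n x * g x \<partial>U01)" for n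
      unfolding distrib_right by (rule Bochner_Integration.integral_add[OF I])
    ultimately show "pairing emb (u + v) g = pairing emb u g + pairing emb v g"
      using LIMSEQ_unique[OF _ tendsto_add[OF yg zg]] by simp
    have "(\<lambda>n. emb (\<lambda>x. c * y n x)) \<longlonglongrightarrow> c *\<^sub>R u"
      using tendsto_scaleR[OF tendsto_const[of c] y(2)] by (simp add: emb_scale y)
    then have "(\<lambda>n. \<integral>x. (c * y n x) * g x \<partial>U01) \<longlonglongrightarrow> pairing emb (c *\<^sub>R u) g"
      by (intro pairing_LIMSEQ g Z_scale y)
    then show "pairing emb (c *\<^sub>R u) g = c *\<^sub>R pairing emb u g"
      using LIMSEQ_unique[OF _ tendsto_mult_left[OF yg, of c]] by (simp add: mult.assoc)
    have "norm (\<integral>x. y n x * g x \<partial>U01) \<le> norm (emb (y n)) * K" for n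
    proof -
      have "\<bar>\<integral>x. y n x * g x \<partial>U01\<bar> \<le> (\<integral>x. \<bar>y n x * g x\<bar> \<partial>U01)" by (rule integral_abs_bound)
      also have "\<dots> \<le> (\<integral>x. \<bar>y n x\<bar> * K \<partial>U01)"
      proof (rule integral_mono)
        show "integrable U01 (\<lambda>x. \<bar>y n x * g x\<bar>)" by (rule integrable_abs[OF I(1)])
        show "integrable U01 (\<lambda>x. \<bar>y n x\<bar> * K)" using Z_integrable[OF Z_abs[OF y(1)]] by simp
      qed (use I K in \<open>auto simp: abs_mult intro: mult_left_mono\<close>)
      also have "\<dots> \<le> N (y n) * K" using L1_le_N[OF y(1)] K(1) by (simp add: mult_right_mono)
      finally show ?thesis by (simp add: norm_emb y)
    qed
    then show "norm (pairing emb u g) \<le> norm u * K"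
      by (intro LIMSEQ_le[OF tendsto_norm[OF yg] tendsto_mult_right[OF tendsto_norm[OF y(2)]]]) auto
  qed
qed

lemma pairing_divide: "pairing emb u (\<lambda>x. g x / c) = pairing emb u g / c"
  unfolding pairing_def by simp

lemma N_haar_pos:
  assumes "1 \<le> j"
  shows "0 < N (haar j)"
proof -
  interpret faithful haar by (rule faithful_haar)
  have "haar j \<noteq> (\<lambda>x. 0)"
  proof
    assume "haar j = (\<lambda>x. 0)"
    then show False using orthogonal[OF assms assms] interval_len_pos[of j] by simp
  qed
  then show ?thesis using N_nonneg[OF h_Z[OF assms]] N_eq_0[OF h_Z[OF assms]] by linarith
qed

lemma pairing_haar_le:
  assumes j: "1 \<le> j"
  shows "\<bar>pairing emb u (haar j)\<bar> \<le> interval_len j / N (haar j) * norm u"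
proof -
  interpret faithful haar by (rule faithful_haar)
  have "norm (pairing emb (emb f) (haar j)) \<le> interval_len j / N (haar j) * N f" if f: "f \<in> Z" for f
    using signed_average_bound[OF f h_Z[OF j] support_in_Z[OF j] abs_h[OF j]] N_haar_pos[OF j]
    by (simp add: pairing_emb[OF f h_Z[OF j]] measure_support[OF j] field_simps)
  from dense_norm_le[OF bounded_linear_pairing[OF h_Z[OF j]] this] show ?thesis by simp
qed

text \<open>One inequality is the averaging bound, the other comes from pairing \<open>haar j\<close> with itself.\<close>

lemma N_mult_dual_norm_haar:
  assumes j: "1 \<le> j"
  shows "N (haar j) * dual_norm emb (haar j) = interval_len j"
proof (rule antisym)
  interpret faithful haar by (rule faithful_haar)
  have "dual_norm emb (haar j) \<le> interval_len j / N (haar j)"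
    unfolding dual_norm_def
    by (rule onorm_bound) (use pairing_haar_le[OF j] N_haar_pos[OF j] interval_len_pos[of j] in auto)
  then show "N (haar j) * dual_norm emb (haar j) \<le> interval_len j"
    using N_haar_pos[OF j] by (simp add: field_simps)
  have "norm (pairing emb (emb (haar j)) (haar j)) \<le> dual_norm emb (haar j) * norm (emb (haar j))"
    unfolding dual_norm_def by (rule onorm[OF bounded_linear_pairing[OF h_Z[OF j]]])
  then show "interval_len j \<le> N (haar j) * dual_norm emb (haar j)"
    using interval_len_pos[of j] by (simp add: pairing_emb h_Z[OF j] norm_emb orthogonal[OF j j] mult.commute)
qed

end

section \<open>Operators that transport coefficients\<close>

lemma rademacher_eq_sum: "rademacher n = (\<lambda>x. \<Sum>i<2^n. haar (Suc (2 ^ n + i)) x)"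
proof
  fix x
  have "rademacher n x = (\<Sum>i<2^n. haarI n (Suc i) x)"
    unfolding rademacher_def
    by (rule sum.reindex_bij_witness[of _ Suc "\<lambda>i. i - 1"]) auto
  also have "\<dots> = (\<Sum>i<2^n. haar (Suc (2 ^ n + i)) x)"
  proof (rule sum.cong[OF refl])
    fix i :: nat assume "i \<in> {..<2^n}"
    then have "haar (2 ^ n + Suc i) = haarI n (Suc i)" by (intro haar_eq_haarI) auto
    then show "haarI n (Suc i) x = haar (Suc (2 ^ n + i)) x" by simp
  qed
  finally show "rademacher n x = (\<Sum>i<2^n. haar (Suc (2 ^ n + i)) x)" .
qed

lemma rademacher_Z: "rademacher n \<in> Z"
  unfolding rademacher_eq_sum by (intro Z_sum Z_haar) auto

lemma rademacher_at_0: "rademacher n 0 = 1"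
proof -
  have "rademacher n 0 = (\<Sum>i<(2::nat)^n. if i = 0 then 1 else 0)"
    unfolding rademacher_eq_sum
    by (intro sum.cong refl) (auto simp: haar_eq_stepf stepf_def cell_def simp del: power_Suc)
  then show ?thesis by simp
qed

context haar_space
begin

lemma initial_norm_antimono: "k \<le> l \<Longrightarrow> initial_norm l \<le> initial_norm k"
proof -
  assume "k \<le> l"
  then have "(1::real) / 2 ^ l \<le> 1 / 2 ^ k" by (simp add: frac_le power_increasing)
  then have "indicator {0..<1 / 2 ^ l} x \<le> (indicator {0..<1 / 2 ^ k} x :: real)" for x :: real
    by (auto simp: indicator_def)
  then show ?thesis unfolding initial_norm_def by (intro N_mono initial_in_Z) simp
qed

text \<open>If the norms of the indicators stay above some \<open>c > 0\<close>, then the averages over \<open>[0, 2\<^sup>-\<^sup>k)\<close> are functionals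
  of norm at most \<open>1 / c\<close>. They converge on \<open>Z\<close> to the evaluation at \<open>0\<close>, which is therefore bounded. But
  every Rademacher function has the value \<open>1\<close> at \<open>0\<close>, so the sequence is not weakly null.\<close>

lemma initial_norm_tendsto_0:
  assumes rad: "weakly_null (\<lambda>n. emb (rademacher n))"
  shows "initial_norm \<longlonglongrightarrow> 0"
proof (rule ccontr)
  assume "\<not> initial_norm \<longlonglongrightarrow> 0"
  then obtain c where c: "0 < c" "\<And>M. \<exists>k\<ge>M. c \<le> \<bar>initial_norm k\<bar>"
    unfolding lim_sequentially dist_real_def by (auto simp: not_less)
  have initial_norm_nonneg: "0 \<le> initial_norm k" for k unfolding initial_norm_def by (rule N_nonneg[OF initial_in_Z])
  have initial_norm_ge: "c \<le> initial_norm k" for k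
  proof -
    obtain l where "k \<le> l" "c \<le> \<bar>initial_norm l\<bar>" using c(2) by blast
    then show ?thesis using initial_norm_antimono[of k l] initial_norm_nonneg[of l] by simp
  qed
  let ?I = "\<lambda>k. indicator {0..<1 / 2 ^ k} :: real \<Rightarrow> real"
  define A where "A k u = 2 ^ k * pairing emb u (?I k)" for k u
  have mI: "measure U01 {0..<1 / 2 ^ k} = 1 / 2 ^ k" for k
    by (subst measure_def, subst emeasure_U01) (auto simp: divide_le_eq)
  have A: "bounded_linear (A k)" for k
    unfolding A_def by (intro bounded_linear_const_mult bounded_linear_pairing initial_in_Z)
  have A_emb: "A k (emb f) = 2 ^ k * (\<integral>x. f x * ?I k x \<partial>U01)" if "f \<in> Z" for f k
    unfolding A_def by (simp only: pairing_emb[OF that initial_in_Z])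
  have "norm (A k (emb f)) \<le> (1 / c) * N f" if f: "f \<in> Z" for f k
  proof -
    let ?i = "\<integral>x. f x * ?I k x \<partial>U01"
    have "\<bar>?i\<bar> * c \<le> \<bar>?i\<bar> * initial_norm k" using initial_norm_ge by (intro mult_left_mono) auto
    also have "\<dots> \<le> 1 / 2 ^ k * N f"
      using average_bound[OF f initial_in_Z[of k]] by (simp only: mI initial_norm_def)
    finally show ?thesis using c(1) by (simp add: A_emb[OF f] abs_mult field_simps)
  qed
  from dense_norm_le[OF A this] have bound: "norm (A k u) \<le> (1 / c) * norm u" for k u .
  have at_0: "(\<lambda>k. A k (emb f)) \<longlonglongrightarrow> f 0" if f: "f \<in> Z" for f
  proof -
    obtain m a where fm: "f = stepf m a" using Z_is_stepf[OF f] by blast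
    have "A k (emb f) = f 0" if "m \<le> k" for k
    proof -
      have "f x * ?I k x = f 0 * ?I k x" for x
      proof (cases "x \<in> {0..<1 / 2 ^ k}")
        case True
        have "(1::real) / 2 ^ k \<le> 1 / 2 ^ m" using that by (simp add: frac_le power_increasing)
        then have x: "0 \<le> x" "x < 1 / 2 ^ m" using True by auto
        have "x < 1" by (rule less_le_trans[OF x(2)]) simp
        then have "x \<in> {0..<1}" using x(1) by simp
        moreover have "cell m x = 0" using x by (simp add: cell_eq_iff)
        moreover have "cell m 0 = 0" by (simp add: cell_def)
        ultimately show ?thesis by (simp add: fm stepf_def)
      qed simp
      then have "A k (emb f) = 2 ^ k * (\<integral>x. f 0 * ?I k x \<partial>U01)" by (simp only: A_emb[OF f])
      also have "(\<integral>x. ?I k x \<partial>U01) = measure U01 {0..<1 / 2 ^ k}"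
        by (rule integral_indicator_Z[OF initial_in_Z])
      then have "2 ^ k * (\<integral>x. f 0 * ?I k x \<partial>U01) = f 0" by (simp add: mI)
      finally show ?thesis .
    qed
    then have "\<forall>\<^sub>F k in sequentially. A k (emb f) = f 0" by (auto simp: eventually_sequentially)
    then show ?thesis by (rule tendsto_eventually)
  qed
  have "\<exists>Q. bounded_linear Q \<and> (\<forall>u. norm (Q u) \<le> (1 / c) * norm u) \<and> (\<forall>u. (\<lambda>n. A n u) \<longlonglongrightarrow> Q u)"
    by (rule pointwise_limit_operator[OF A bound]) (use c at_0 in \<open>auto simp: convergent_def\<close>)
  then obtain Q where Q: "bounded_linear Q" "\<And>u. (\<lambda>n. A n u) \<longlonglongrightarrow> Q u" by blast
  have "Q (emb (rademacher n)) = 1" for n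
    using LIMSEQ_unique[OF Q(2) at_0[OF rademacher_Z]] by (simp add: rademacher_at_0)
  moreover have "(\<lambda>n. Q (emb (rademacher n))) \<longlonglongrightarrow> 0"
    using rad Q(1) unfolding weakly_null_def by blast
  ultimately show False by (simp add: LIMSEQ_const_iff)
qed

text \<open>Partial sums of the operator that sends each \<open>g j\<close> to \<open>h j\<close>.\<close>

definition transport :: "(nat \<Rightarrow> real \<Rightarrow> real) \<Rightarrow> (nat \<Rightarrow> real \<Rightarrow> real) \<Rightarrow> nat \<Rightarrow> 'f \<Rightarrow> 'f" where
  "transport g h n u = (\<Sum>j=1..2^n. (pairing emb u (g j) / interval_len j) *\<^sub>R emb (h j))"

lemma transport_emb:
  assumes "faithful g" "faithful h" "f \<in> Z"
  shows "transport g h n (emb f) = emb (\<lambda>x. \<Sum>j=1..2^n. haar_coef g f j * h j x)"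
proof -
  interpret G: faithful g by fact
  interpret H: faithful h by fact
  have "emb (\<lambda>x. \<Sum>j=1..2^n. haar_coef g f j * h j x) = (\<Sum>j=1..2^n. emb (\<lambda>x. haar_coef g f j * h j x))"
    by (intro emb_sum Z_scale H.h_Z) auto
  also have "\<dots> = transport g h n (emb f)"
    unfolding transport_def
  proof (rule sum.cong[OF refl])
    fix j :: nat assume "j \<in> {1..2^n}"
    then have j: "1 \<le> j" by simp
    show "emb (\<lambda>x. haar_coef g f j * h j x) = (pairing emb (emb f) (g j) / interval_len j) *\<^sub>R emb (h j)"
      by (simp only: emb_scale[OF H.h_Z[OF j]] pairing_emb[OF assms(3) G.h_Z[OF j]] haar_coef_def)
  qed
  finally show ?thesis by simp
qed

text \<open>The partial sums are contractions, and on \<open>Z\<close> they form Cauchy sequences, so they converge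
  everywhere. On \<open>g i\<close> they are eventually constant.\<close>

lemma transport_limit:
  assumes "faithful g" "faithful h" and initial_norm: "initial_norm \<longlonglongrightarrow> 0"
  obtains Q where "bounded_linear Q" "\<And>u. norm (Q u) \<le> norm u" "\<And>u. (\<lambda>n. transport g h n u) \<longlonglongrightarrow> Q u"
    "\<And>i. 1 \<le> i \<Longrightarrow> Q (emb (g i)) = emb (h i)"
proof -
  interpret G: faithful g by fact
  interpret H: faithful h by fact
  have lin: "bounded_linear (transport g h n)" for n
    unfolding transport_def
    by (intro bounded_linear_sum bounded_linear_scaleR_left[THEN bounded_linear_compose]
        bounded_linear_divide[THEN bounded_linear_compose] bounded_linear_pairing G.h_Z) auto
  have "norm (transport g h n (emb f)) \<le> 1 * N f" if f: "f \<in> Z" for f n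
    unfolding transport_emb[OF assms(1,2) f] norm_emb[OF H.partial_sum_Z]
    using N_transport_le[OF assms(1,2) f] by simp
  from dense_norm_le[OF lin this] have bound: "norm (transport g h n u) \<le> 1 * norm u" for n u .
  have conv: "convergent (\<lambda>n. transport g h n (emb f))" if f: "f \<in> Z" for f
  proof (rule Cauchy_convergent, rule CauchyI')
    fix e :: real assume "0 < e"
    then obtain M where M: "\<And>m n. M \<le> m \<Longrightarrow> m \<le> n \<Longrightarrow>
        N (\<lambda>x. \<Sum>j\<in>{2^m<..2^n}. haar_coef g f j * h j x) < e"
      using transport_Cauchy[OF assms(1,2) f initial_norm] by metis
    have "dist (transport g h m (emb f)) (transport g h n (emb f)) < e" if mn: "M \<le> m" "m < n" for m n
    proof -
      have mn': "(2::nat) ^ m \<le> 2 ^ n" using mn by (intro power_increasing) auto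
      have "(\<lambda>x. \<Sum>j\<in>{2^m<..2^n}. haar_coef g f j * h j x) =
        (\<lambda>x. (\<Sum>j=1..2^n. haar_coef g f j * h j x) - (\<Sum>j=1..2^m. haar_coef g f j * h j x))"
        by (rule ext) (rule sum_greaterThanAtMost_eq_diff[OF mn'])
      then have "emb (\<lambda>x. \<Sum>j\<in>{2^m<..2^n}. haar_coef g f j * h j x) =
          transport g h n (emb f) - transport g h m (emb f)"
        unfolding transport_emb[OF assms(1,2) f] by (simp only: emb_diff[OF H.partial_sum_Z H.partial_sum_Z])
      moreover have "norm (emb (\<lambda>x. \<Sum>j\<in>{2^m<..2^n}. haar_coef g f j * h j x)) < e"
        using M[of m n] mn by (subst norm_emb) (auto intro!: Z_sum Z_scale H.h_Z)
      ultimately show ?thesis by (simp add: dist_norm norm_minus_commute)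
    qed
    then show "\<exists>M. \<forall>m\<ge>M. \<forall>n>m. dist (transport g h m (emb f)) (transport g h n (emb f)) < e" by blast
  qed
  obtain Q where Q: "bounded_linear Q" "\<And>u. norm (Q u) \<le> 1 * norm u" "\<And>u. (\<lambda>n. transport g h n u) \<longlonglongrightarrow> Q u"
    using pointwise_limit_operator[OF lin bound _ conv] by auto
  have "Q (emb (g i)) = emb (h i)" if i: "1 \<le> i" for i
  proof (rule LIMSEQ_unique[OF Q(3)])
    have "transport g h n (emb (g i)) = emb (h i)" if "i \<le> n" for n
    proof -
      have "i \<le> 2 ^ n" using that less_exp[of n] by linarith
      have "(\<Sum>j=1..2^n. haar_coef g (g i) j * h j x) = (\<Sum>j=1..2^n. if j = i then h j x else 0)" for x
        using i by (intro sum.cong) (auto simp: G.haar_coef_self)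
      then have "(\<lambda>x. \<Sum>j=1..2^n. haar_coef g (g i) j * h j x) = h i"
        using i \<open>i \<le> 2 ^ n\<close> by auto
      then show ?thesis by (simp only: transport_emb[OF assms(1,2) G.h_Z[OF i]])
    qed
    then have "\<forall>\<^sub>F n in sequentially. transport g h n (emb (g i)) = emb (h i)"
      by (auto simp: eventually_sequentially)
    then show "(\<lambda>n. transport g h n (emb (g i))) \<longlonglongrightarrow> emb (h i)" by (rule tendsto_eventually)
  qed
  then show ?thesis using that Q by simp
qed

text \<open>The coefficient of \<open>u\<close> at \<open>haar i\<close> is at most \<open>norm u / N (haar i)\<close>, so the series
  \<open>\<Sum>\<^sub>i \<langle>u, haar i\<rangle> / |I\<^sub>i| r\<^sub>i\<close> converges absolutely. By orthogonality its sum at \<open>haar i\<close> is \<open>r i\<close>.\<close>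

lemma summable_perturbation:
  fixes r :: "nat \<Rightarrow> 'f"
  assumes sum_le: "\<And>m. (\<Sum>i=1..m. norm (r i) / N (haar i)) \<le> \<eta>"
  obtains R where "bounded_linear R" "\<And>u. norm (R u) \<le> \<eta> * norm u"
    "\<And>i. 1 \<le> i \<Longrightarrow> R (emb (haar i)) = r i"
proof -
  interpret H: faithful haar by (rule faithful_haar)
  \<comment> \<open>The Haar functions are indexed from \<open>1\<close>, series from \<open>0\<close>.\<close>
  define s where "s i = norm (r (Suc i)) / N (haar (Suc i))" for i
  define t where "t i u = (pairing emb u (haar (Suc i)) / interval_len (Suc i)) *\<^sub>R r (Suc i)" for i u
  have s0: "0 \<le> s i" for i unfolding s_def by (intro divide_nonneg_nonneg N_nonneg Z_haar) auto
  have "(\<Sum>i<m. s i) = (\<Sum>i=1..m. norm (r i) / N (haar i))" for m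
    unfolding s_def by (rule sum.reindex_bij_witness[of _ "\<lambda>i. i - 1" Suc]) auto
  then have part: "(\<Sum>i<m. s i) \<le> \<eta>" for m using sum_le by simp
  have sum_s: "summable s" by (rule bounded_imp_summable[of s \<eta>])
    (use s0 part[of "Suc _"] in \<open>auto simp: lessThan_Suc_atMost\<close>)
  have suminf_s: "suminf s \<le> \<eta>" by (rule suminf_le_const[OF sum_s part])
  have t_lin: "bounded_linear (t i)" for i
    unfolding t_def
    by (intro bounded_linear_scaleR_left[THEN bounded_linear_compose]
        bounded_linear_divide[THEN bounded_linear_compose] bounded_linear_pairing Z_haar) simp
  have t_le: "norm (t i u) \<le> s i * norm u" for i u
  proof -
    have "\<bar>pairing emb u (haar (Suc i))\<bar> / interval_len (Suc i) \<le> norm u / N (haar (Suc i))"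
      using pairing_haar_le[of "Suc i" u] interval_len_pos[of "Suc i"] N_haar_pos[of "Suc i"]
      by (simp add: field_simps)
    then have "\<bar>pairing emb u (haar (Suc i))\<bar> / interval_len (Suc i) * norm (r (Suc i)) \<le>
        norm u / N (haar (Suc i)) * norm (r (Suc i))" by (rule mult_right_mono) simp
    then show ?thesis using interval_len_pos[of "Suc i"] by (simp add: t_def s_def mult.commute)
  qed
  have sum_norm: "summable (\<lambda>i. norm (t i u))" for u
    by (rule summable_comparison_test'[OF summable_mult2[OF sum_s, of "norm u"], of 0]) (use t_le in auto)
  then have sum_t: "summable (\<lambda>i. t i u)" for u by (rule summable_norm_cancel)
  define R where "R u = (\<Sum>i. t i u)" for u
  have lin: "linear (t i)" for i by (rule bounded_linear.linear[OF t_lin])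
  have R_le: "norm (R u) \<le> \<eta> * norm u" for u
  proof -
    have "norm (R u) \<le> (\<Sum>i. norm (t i u))" unfolding R_def by (rule summable_norm[OF sum_norm])
    also have "\<dots> \<le> (\<Sum>i. s i * norm u)"
      by (rule suminf_le[OF _ sum_norm summable_mult2[OF sum_s]]) (rule t_le)
    also have "\<dots> = suminf s * norm u" by (rule suminf_mult2[OF sum_s, symmetric])
    also have "\<dots> \<le> \<eta> * norm u" by (rule mult_right_mono[OF suminf_s]) simp
    finally show ?thesis .
  qed
  have "bounded_linear R"
  proof (rule bounded_linear_intro)
    show "R (u + v) = R u + R v" for u v
      unfolding R_def linear_add[OF lin] by (rule suminf_add[OF sum_t sum_t, symmetric])
    show "R (c *\<^sub>R u) = c *\<^sub>R R u" for c u
      unfolding R_def linear_scale[OF lin] by (rule suminf_scaleR_right[OF sum_t, symmetric])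
    show "norm (R u) \<le> norm u * \<eta>" for u using R_le[of u] by (simp add: mult.commute)
  qed
  moreover have "R (emb (haar i)) = r i" if i: "1 \<le> i" for i
  proof -
    have "t k (emb (haar i)) = (if k = i - 1 then r i else 0)" for k
      using i interval_len_pos[of i] by (auto simp: t_def pairing_emb H.h_Z H.orthogonal)
    then have "(\<lambda>k. t k (emb (haar i))) sums r i" using sums_single[of "i - 1" "\<lambda>_. r i"] by simp
    then show ?thesis unfolding R_def by (rule sums_unique[symmetric])
  qed
  ultimately show ?thesis using that R_le by blast
qed

end

section \<open>The diagonal operator\<close>

lemma finite_sum_le_infsum_ennreal:
  fixes f :: "'a \<Rightarrow> ennreal"
  assumes "finite B" "B \<subseteq> A"
  shows "sum f B \<le> infsum f A"
proof -
  have "infsum f A = (SUP F\<in>{F. finite F \<and> F \<subseteq> A}. sum f F)"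
    by (rule nonneg_infsum_complete) simp
  then show ?thesis using assms by (auto intro: SUP_upper)
qed

lemma finite_double_sum_le:
  fixes a :: "nat \<Rightarrow> nat \<Rightarrow> real"
  assumes le: "(\<Sum>\<^sub>\<infinity>i\<in>{1..}. \<Sum>\<^sub>\<infinity>j\<in>{1..} - {i}. ennreal (a i j)) < ennreal \<eta>"
    and a: "\<And>i j. 0 \<le> a i j" and \<eta>: "0 < \<eta>"
    and I: "finite I" "I \<subseteq> {1..}" and J: "finite J" "J \<subseteq> {1..}"
  shows "(\<Sum>i\<in>I. \<Sum>j\<in>J - {i}. a i j) \<le> (\<eta>::real)"
proof -
  have "ennreal (\<Sum>i\<in>I. \<Sum>j\<in>J - {i}. a i j) = (\<Sum>i\<in>I. \<Sum>j\<in>J - {i}. ennreal (a i j))"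
    using a by (simp add: sum_ennreal sum_nonneg)
  also have "\<dots> \<le> (\<Sum>i\<in>I. \<Sum>\<^sub>\<infinity>j\<in>{1..} - {i}. ennreal (a i j))"
  proof (rule sum_mono)
    fix i
    show "(\<Sum>j\<in>J - {i}. ennreal (a i j)) \<le> (\<Sum>\<^sub>\<infinity>j\<in>{1..} - {i}. ennreal (a i j))"
      by (rule finite_sum_le_infsum_ennreal) (use J in auto)
  qed
  also have "\<dots> \<le> (\<Sum>\<^sub>\<infinity>i\<in>{1..}. \<Sum>\<^sub>\<infinity>j\<in>{1..} - {i}. ennreal (a i j))"
    by (rule finite_sum_le_infsum_ennreal[OF I])
  finally have "ennreal (\<Sum>i\<in>I. \<Sum>j\<in>J - {i}. a i j) \<le> ennreal \<eta>" using le by simp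
  then show ?thesis using \<eta> by (simp add: ennreal_le_iff)
qed

theorem theorem3p5:
  fixes N :: "(real \<Rightarrow> real) \<Rightarrow> real"
    and emb :: "(real \<Rightarrow> real) \<Rightarrow> 'f::banach"
    and T :: "'f \<Rightarrow> 'f"
    and ht :: "nat \<Rightarrow> real \<Rightarrow> real"
    and \<delta> \<eta> :: real
  assumes F: "haar_system_space N emb"
    and rad: "weakly_null (\<lambda>n. emb (rademacher n))"
    and \<delta>: "\<delta> > 0"
    and T: "bounded_linear T"
    and T_diag: "\<And>j. j \<ge> 1 \<Longrightarrow>
      pairing emb (T (emb (haar j))) (haar j) \<ge> \<delta> * N (haar j) * dual_norm emb (haar j)"
    and \<eta>: "\<eta> > 0"
    and ht: "faithful_haar_system ht"
    and i: "(\<Sum>\<^sub>\<infinity>i\<in>{1..}. \<Sum>\<^sub>\<infinity>j\<in>{1..} - {i}.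
        ennreal \<bar>pairing emb (T (emb (\<lambda>x. ht i x / N (haar i))))
                  (\<lambda>x. ht j x / dual_norm emb (haar j))\<bar>) < ennreal \<eta>"
    and ii: "\<And>j. j \<ge> 1 \<Longrightarrow>
      pairing emb (T (emb (ht j))) (ht j) \<ge> \<delta> * N (ht j) * dual_norm emb (ht j)"
  shows "\<exists>D. bounded_linear D \<and>
    (\<forall>j\<ge>1. D (emb (haar j)) =
       pairing emb (T (emb (\<lambda>x. ht j x / N (haar j)))) (\<lambda>x. ht j x / dual_norm emb (haar j))
         *\<^sub>R emb (haar j)) \<and>
    (\<exists>A B :: 'f \<Rightarrow> 'f. bounded_linear A \<and> bounded_linear B \<and> onorm A * onorm B \<le> 1 \<and>
       onorm (\<lambda>u. D u - B (T (A u))) \<le> 2 * \<eta> \<and>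
       onorm D \<le> onorm T + 2 * \<eta>)"
proof -
  interpret haar_space N emb by (rule haar_space.intro[OF F])
  interpret H: faithful haar by (rule faithful_haar)
  interpret G: faithful ht by (rule faithful.intro[OF ht])
  note initial_norm = initial_norm_tendsto_0[OF rad]
  obtain A where A: "bounded_linear A" "\<And>u. norm (A u) \<le> norm u"
    and A_haar: "\<And>i. 1 \<le> i \<Longrightarrow> A (emb (haar i)) = emb (ht i)"
    using transport_limit[OF H.faithful_axioms G.faithful_axioms initial_norm] by metis
  obtain B where B: "bounded_linear B" "\<And>u. norm (B u) \<le> norm u"
    and B_lim: "\<And>u. (\<lambda>n. transport ht haar n u) \<longlonglongrightarrow> B u"
    using transport_limit[OF G.faithful_axioms H.faithful_axioms initial_norm] by metis
  \<comment> \<open>The matrix of \<open>T\<close> with respect to the system \<open>ht\<close>.\<close>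
  define p where "p i j = pairing emb (T (emb (ht i))) (ht j)" for i j
  define a where "a i j = \<bar>p i j / (N (haar i) * dual_norm emb (haar j))\<bar>" for i j
  have dual: "dual_norm emb (haar j) = interval_len j / N (haar j)" if "1 \<le> j" for j
    using N_mult_dual_norm_haar[OF that] N_haar_pos[OF that] by (simp add: field_simps)
  have entry: "pairing emb (T (emb (\<lambda>x. ht i x / N (haar i)))) (\<lambda>x. ht j x / dual_norm emb (haar j)) =
      p i j / (N (haar i) * dual_norm emb (haar j))" if ij: "1 \<le> i" "1 \<le> j" for i j
  proof -
    have "emb (\<lambda>x. ht i x / N (haar i)) = (1 / N (haar i)) *\<^sub>R emb (ht i)"
      using emb_scale[OF G.h_Z[OF ij(1)], of "1 / N (haar i)"] by simp
    then have "T (emb (\<lambda>x. ht i x / N (haar i))) = (1 / N (haar i)) *\<^sub>R T (emb (ht i))"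
      using linear_scale[OF bounded_linear.linear[OF T]] by simp
    moreover have "pairing emb ((1 / N (haar i)) *\<^sub>R T (emb (ht i))) (ht j) = (1 / N (haar i)) * p i j"
      using linear_scale[OF bounded_linear.linear[OF bounded_linear_pairing[OF G.h_Z[OF ij(2)]]]]
      by (simp add: p_def)
    ultimately show ?thesis by (simp only: pairing_divide) simp
  qed
  have entry_diag: "p i i / (N (haar i) * dual_norm emb (haar i)) = p i i / interval_len i" if "1 \<le> i" for i
    by (simp only: N_mult_dual_norm_haar[OF that])
  have a_sum: "(\<Sum>i\<in>I. \<Sum>j\<in>J - {i}. a i j) \<le> \<eta>"
    if "finite I" "I \<subseteq> {1..}" "finite J" "J \<subseteq> {1..}" for I J
  proof (rule finite_double_sum_le[OF _ _ \<eta> that])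
    have "(\<Sum>\<^sub>\<infinity>i\<in>{1..}. \<Sum>\<^sub>\<infinity>j\<in>{1..} - {i}. ennreal (a i j)) =
      (\<Sum>\<^sub>\<infinity>i\<in>{1..}. \<Sum>\<^sub>\<infinity>j\<in>{1..} - {i}.
        ennreal \<bar>pairing emb (T (emb (\<lambda>x. ht i x / N (haar i))))
                  (\<lambda>x. ht j x / dual_norm emb (haar j))\<bar>)"
    proof (intro infsum_cong)
      fix i j :: nat assume "i \<in> {1..}" "j \<in> {1..} - {i}"
      then have ij: "1 \<le> i" "1 \<le> j" by auto
      show "ennreal (a i j) = ennreal \<bar>pairing emb (T (emb (\<lambda>x. ht i x / N (haar i))))
                  (\<lambda>x. ht j x / dual_norm emb (haar j))\<bar>"
        by (simp only: entry[OF ij] a_def)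
    qed
    then show "(\<Sum>\<^sub>\<infinity>i\<in>{1..}. \<Sum>\<^sub>\<infinity>j\<in>{1..} - {i}. ennreal (a i j)) < ennreal \<eta>"
      using i by (simp only:)
  qed (simp add: a_def)
  \<comment> \<open>The error that \<open>B T A\<close> makes on \<open>haar i\<close>: the series of the off-diagonal entries of row \<open>i\<close>, up to
    sign.\<close>
  define r where "r i = (p i i / interval_len i) *\<^sub>R emb (haar i) - B (T (emb (ht i)))" for i
  have r_bound: "norm ((p i i / interval_len i) *\<^sub>R emb (haar i) - transport ht haar n (T (emb (ht i)))) / N (haar i)
      \<le> (\<Sum>j\<in>{1..2^n} - {i}. a i j)" if i: "1 \<le> i" "i \<le> 2 ^ n" for i n
  proof -
    have "transport ht haar n (T (emb (ht i))) = (p i i / interval_len i) *\<^sub>R emb (haar i) +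
        (\<Sum>j\<in>{1..2^n} - {i}. (p i j / interval_len j) *\<^sub>R emb (haar j))"
      unfolding transport_def p_def using i by (intro sum.remove) auto
    then have "norm ((p i i / interval_len i) *\<^sub>R emb (haar i) - transport ht haar n (T (emb (ht i)))) =
        norm (\<Sum>j\<in>{1..2^n} - {i}. (p i j / interval_len j) *\<^sub>R emb (haar j))" by simp
    also have "\<dots> \<le> (\<Sum>j\<in>{1..2^n} - {i}. norm ((p i j / interval_len j) *\<^sub>R emb (haar j)))" by (rule norm_sum)
    also have "\<dots> \<le> (\<Sum>j\<in>{1..2^n} - {i}. a i j * N (haar i))"
    proof (rule sum_mono)
      fix j assume "j \<in> {1..2^n} - {i}"
      then have j: "1 \<le> j" by auto
      show "norm ((p i j / interval_len j) *\<^sub>R emb (haar j)) \<le> a i j * N (haar i)"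
        using N_haar_pos[OF i(1)] N_haar_pos[OF j] interval_len_pos[of j]
        by (simp add: a_def dual[OF j] norm_emb[OF H.h_Z[OF j]] abs_mult field_simps)
    qed
    also have "\<dots> = (\<Sum>j\<in>{1..2^n} - {i}. a i j) * N (haar i)" by (rule sum_distrib_right[symmetric])
    finally show ?thesis using N_haar_pos[OF i(1)] by (simp add: divide_le_eq)
  qed
  have "(\<Sum>i=1..m. norm (r i) / N (haar i)) \<le> \<eta>" for m
  proof (rule LIMSEQ_le_const2)
    show "(\<lambda>n. \<Sum>i=1..m. norm ((p i i / interval_len i) *\<^sub>R emb (haar i) - transport ht haar n (T (emb (ht i)))) / N (haar i))
        \<longlonglongrightarrow> (\<Sum>i=1..m. norm (r i) / N (haar i))"
      unfolding r_def divide_inverse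
      by (intro tendsto_sum tendsto_mult_right tendsto_norm tendsto_diff tendsto_const B_lim)
    have "(\<Sum>i=1..m. norm ((p i i / interval_len i) *\<^sub>R emb (haar i) - transport ht haar n (T (emb (ht i)))) / N (haar i)) \<le> \<eta>"
      if "m \<le> n" for n
    proof -
      have mn: "m \<le> 2 ^ n" using that less_exp[of n] by linarith
      have "(\<Sum>i=1..m. norm ((p i i / interval_len i) *\<^sub>R emb (haar i) - transport ht haar n (T (emb (ht i)))) / N (haar i))
         \<le> (\<Sum>i=1..m. \<Sum>j\<in>{1..2^n} - {i}. a i j)"
        using mn by (intro sum_mono r_bound) auto
      also have "\<dots> \<le> \<eta>" by (rule a_sum) auto
      finally show ?thesis .
    qed
    then show "\<exists>M. \<forall>n\<ge>M. (\<Sum>i=1..m. norm ((p i i / interval_len i) *\<^sub>R emb (haar i) -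
        transport ht haar n (T (emb (ht i)))) / N (haar i)) \<le> \<eta>" by blast
  qed
  then obtain R where R: "bounded_linear R" "\<And>u. norm (R u) \<le> \<eta> * norm u"
    and R_haar: "\<And>i. 1 \<le> i \<Longrightarrow> R (emb (haar i)) = r i"
    using summable_perturbation by blast
  \<comment> \<open>The correction \<open>R\<close> restores the prescribed diagonal values exactly.\<close>
  define D where "D u = B (T (A u)) + R u" for u
  have BTA: "bounded_linear (\<lambda>u. B (T (A u)))"
    by (rule bounded_linear_compose[OF B(1) bounded_linear_compose[OF T A(1)]])
  have D_lin: "bounded_linear D"
    unfolding D_def by (rule bounded_linear_add[OF BTA R(1)])
  have D_haar: "D (emb (haar j)) =
       pairing emb (T (emb (\<lambda>x. ht j x / N (haar j)))) (\<lambda>x. ht j x / dual_norm emb (haar j))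
         *\<^sub>R emb (haar j)" if j: "1 \<le> j" for j
    unfolding entry[OF j j] entry_diag[OF j] D_def A_haar[OF j] R_haar[OF j] r_def by simp
  have T_le: "norm (T v) \<le> onorm T * norm v" for v by (rule onorm[OF T])
  have onT: "0 \<le> onorm T" by (rule onorm_pos_le[OF T])
  have "onorm A \<le> 1" "onorm B \<le> 1" using A(2) B(2) by (auto intro: onorm_bound)
  then have AB: "onorm A * onorm B \<le> 1"
    using onorm_pos_le[OF A(1)] onorm_pos_le[OF B(1)] by (simp add: mult_le_one)
  have "onorm R \<le> \<eta>" using R(2) \<eta> by (intro onorm_bound) auto
  moreover have "(\<lambda>u. D u - B (T (A u))) = R" by (simp add: D_def fun_eq_iff)
  ultimately have diff: "onorm (\<lambda>u. D u - B (T (A u))) \<le> 2 * \<eta>" using \<eta> by simp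
  have "norm (D u) \<le> (onorm T + \<eta>) * norm u" for u
  proof -
    have "norm (B (T (A u))) \<le> onorm T * norm (A u)" using B(2)[of "T (A u)"] T_le[of "A u"] by linarith
    also have "\<dots> \<le> onorm T * norm u" by (rule mult_left_mono[OF A(2) onT])
    finally show ?thesis
      using norm_triangle_ineq[of "B (T (A u))" "R u"] R(2)[of u] by (simp add: D_def distrib_right)
  qed
  then have "onorm D \<le> onorm T + \<eta>" using onT \<eta> by (intro onorm_bound) auto
  then have D_le: "onorm D \<le> onorm T + 2 * \<eta>" using \<eta> by simp
  show ?thesis
    using D_lin D_haar A(1) B(1) AB diff D_le by blast
qed

end
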